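(* Let $p\ge 1$. A function $\Phi:L^p(\mathbb{C},S^{n-1})\to\mathbb{C}$ is a continuous rotation invariant valuation if and only if there exist continuous functions $h_k:\mathbb{R}\to\mathbb{R}$ ($k=1,2,3,4$) with the properties that $h_k(0)=0$ and there exist constants $\gamma_k,\delta_k\ge 0$ such that $|h_k(a)|\le\gamma_k|a|^p+\delta_k$ for all $a\in\mathbb{R}$ ($k=1,2,3,4$), and $$\Phi(f)=\int_{S^{n-1}}(h_1\circ\Re f+h_3\circ\Im f)(u)\,du+i\int_{S^{n-1}}(h_2\circ\Re f+h_4\circ\Im f)(u)\,du$$ for all $f\in L^p(\mathbb{C},S^{n-1})$.
   Context: $S^{n-1}$ is the unit sphere in $\mathbb{R}^n$, and $du$ denotes integration with respect to spherical Lebesgue measure, defined on the $\sigma$-algebra of sets $E\subseteq S^{n-1}$ such that $\{\lambda x: x\in E,\ 0\le\lambda\le 1\}$ is Lebesgue measurable in $\mathbb{R}^n$. $L^p(\mathbb{C},S^{n-1})$ is the $L^p$ space of spherical Lebesgue measurable functions $f:S^{n-1}\to\mathbb{C}$ with $\|f\|_p=(\int_{S^{n-1}}|f|^p\,du)^{1/p}<\infty$, where functions equal almost everywhere are identified. $\Re f$ and $\Im f$ are the real and imaginary parts of $f$. For complex-valued functions $f,g$, define $f\vee g=\max(\Re f,\Re g)+i\max(\Im f,\Im g)$ and $f\wedge g=\min(\Re f,\Re g)+i\min(\Im f,\Im g)$ (pointwise). A function $\Phi:L^p(\mathbb{C},S^{n-1})\to\mathbb{C}$ is a valuation if $\Phi(f\vee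 g)+\Phi(f\wedge g)=\Phi(f)+\Phi(g)$ for all $f,g$ in the space and $\Phi(0)=0$. It is continuous if $\Phi(f_i)\to\Phi(f)$ whenever $\|f_i-f\|_p\to 0$. It is rotation invariant if $\Phi(f\circ\theta^{-1})=\Phi(f)$ for every $f$ in the space and every $\theta\in \mathrm{O}(n)$, where $\mathrm{O}(n)$ is the orthogonal group of $\mathbb{R}^n$ and $\theta^{-1}$ is the inverse of $\theta$.
   Formalization: The formal theorem assumes n ≥ 2; for n = 1 the sphere is two points of positive measure and the claim fails: the sum of e^{Re f(u)} − 1 over both points is a continuous rotation invariant valuation, but it forces h_1(a) = e^a − 1, violating the growth bound. *)

theory Defs
  imports "HOL-Analysis.Analysis"
begin

definition radial_cone :: "(real^'n) set \<Rightarrow> (real^'n) set" where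
  "radial_cone E = {l *\<^sub>R x | l x. x \<in> E \<and> 0 \<le> l \<and> l \<le> 1}"

definition spherical_sets :: "(real^'n) set set" where
  "spherical_sets = {E. E \<subseteq> sphere 0 1 \<and> radial_cone E \<in> sets lebesgue}"

text \<open>Spherical Lebesgue measure on the unit sphere, normalised in the usual way: the measure of a
  set is \<open>n\<close> times the volume of the cone over it. The lemmas \<open>sets_spherical_lebesgue\<close> and
  \<open>emeasure_spherical_lebesgue\<close> below confirm that \<^const>\<open>measure_of\<close> does not degenerate here.\<close>

definition spherical_lebesgue :: "(real^'n) measure" where
  "spherical_lebesgue = measure_of (sphere 0 1) spherical_sets
     (\<lambda>E. of_nat CARD('n) * emeasure lebesgue (radial_cone E))"

lemma radial_cone_Int_sphere:
  fixes E :: "(real^'n) set"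
  assumes "E \<subseteq> sphere 0 1" "x \<noteq> 0"
  shows "x \<in> radial_cone E \<longleftrightarrow> norm x \<le> 1 \<and> x /\<^sub>R norm x \<in> E"
proof
  assume "x \<in> radial_cone E"
  then obtain l y where "x = l *\<^sub>R y" "y \<in> E" "0 \<le> l" "l \<le> 1"
    unfolding radial_cone_def by blast
  moreover have "norm y = 1" using calculation assms by auto
  ultimately show "norm x \<le> 1 \<and> x /\<^sub>R norm x \<in> E" using assms by simp
next
  assume "norm x \<le> 1 \<and> x /\<^sub>R norm x \<in> E"
  moreover have "x = norm x *\<^sub>R (x /\<^sub>R norm x)" using assms by simp
  ultimately show "x \<in> radial_cone E" unfolding radial_cone_def
    by (metis (mono_tags, lifting) mem_Collect_eq norm_ge_zero)
qed

lemma lebesgue_insert_zero_iff: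
  fixes A :: "(real^'n) set"
  shows "A - {0} \<in> sets lebesgue \<longleftrightarrow> A \<in> sets lebesgue"
proof
  assume "A - {0} \<in> sets lebesgue"
  then have "(A - {0}) \<union> (A \<inter> {0}) \<in> sets lebesgue"
    by (intro sets.Un) (auto simp: Int_insert_right)
  then show "A \<in> sets lebesgue" by (simp add: Un_Diff_Int Un_commute)
qed auto

lemma sigma_algebra_spherical_sets:
  "sigma_algebra (sphere 0 1) (spherical_sets :: (real^'n) set set)"
proof -
  have iff: "E \<in> spherical_sets \<longleftrightarrow> E \<subseteq> sphere 0 1 \<and> radial_cone E - {0} \<in> sets lebesgue"
    for E :: "(real^'n) set"
    by (simp add: spherical_sets_def lebesgue_insert_zero_iff)
  have compl: "radial_cone (sphere 0 1 - E) - {0} = (cball 0 1 - {0}) - (radial_cone E - {0})"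
    if "E \<subseteq> sphere 0 1" for E :: "(real^'n) set"
    using that by (auto simp: radial_cone_Int_sphere)
  have UN: "radial_cone (\<Union>i. E i) - {0} = (\<Union>i. radial_cone (E i) - {0})"
    for E :: "nat \<Rightarrow> (real^'n) set"
    by (auto simp: radial_cone_def)
  show ?thesis
    unfolding sigma_algebra_iff2
  proof (intro conjI ballI allI impI)
    show "{} \<in> (spherical_sets :: (real^'n) set set)"
      by (simp add: spherical_sets_def radial_cone_def)
  next
    fix E :: "(real^'n) set" assume E: "E \<in> spherical_sets"
    then show "sphere 0 1 - E \<in> spherical_sets"
      unfolding iff using compl[of E] by (auto intro!: sets.Diff lmeasurable_cball)
  next
    fix E :: "nat \<Rightarrow> (real^'n) set" assume "range E \<subseteq> spherical_sets"
    then have *: "E i \<subseteq> sphere 0 1" "radial_cone (E i) - {0} \<in> sets lebesgue" for i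
      unfolding iff[symmetric] using iff by auto
    show "(\<Union>i. E i) \<in> spherical_sets"
      unfolding iff UN
      by (intro conjI UN_least sets.countable_UN) (use * in auto)
  next
    show "spherical_sets \<subseteq> Pow (sphere 0 1 :: (real^'n) set)"
      by (auto simp: spherical_sets_def)
  qed
qed

lemma space_spherical_lebesgue [simp]: "space spherical_lebesgue = sphere 0 1"
  unfolding spherical_lebesgue_def
  by (rule space_measure_of) (auto simp: spherical_sets_def)

lemma sets_spherical_lebesgue: "sets spherical_lebesgue = spherical_sets"
  unfolding spherical_lebesgue_def
  by (rule sigma_algebra.sets_measure_of_eq[OF sigma_algebra_spherical_sets])

lemma emeasure_spherical_lebesgue:
  fixes E :: "(real^'n) set"
  assumes "E \<in> spherical_sets"
  shows "emeasure spherical_lebesgue E = of_nat CARD('n) * emeasure lebesgue (radial_cone E)"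
  unfolding spherical_lebesgue_def
proof (rule emeasure_measure_of_sigma)
  let ?m = "\<lambda>E :: (real^'n) set. of_nat CARD('n) * emeasure lebesgue (radial_cone E)"
  show "positive spherical_sets ?m"
    by (simp add: positive_def radial_cone_def)
  have eq: "?m E = of_nat CARD('n) * emeasure lebesgue (radial_cone E - {0})" 
    if "E \<in> spherical_sets" for E :: "(real^'n) set"
    using that by (subst emeasure_Diff_null_set) (auto simp: spherical_sets_def null_sets_def)
  show "countably_additive spherical_sets ?m"
  proof (rule countably_additiveI)
    fix E :: "nat \<Rightarrow> (real^'n) set"
    assume E: "range E \<subseteq> spherical_sets" "disjoint_family E" "(\<Union>i. E i) \<in> spherical_sets"
    have sub: "E i \<subseteq> sphere 0 1" for i using E by (auto simp: spherical_sets_def)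
    have UN: "radial_cone (\<Union>i. E i) - {0} = (\<Union>i. radial_cone (E i) - {0})"
      by (auto simp: radial_cone_def)
    have "disjoint_family (\<lambda>i. radial_cone (E i) - {0})"
      unfolding disjoint_family_on_def
    proof (intro ballI impI)
      fix i j :: nat assume "i \<noteq> j"
      then have "E i \<inter> E j = {}" using E(2) by (simp add: disjoint_family_on_def)
      then show "(radial_cone (E i) - {0}) \<inter> (radial_cone (E j) - {0}) = {}"
        using sub[of i] sub[of j] by (auto simp: radial_cone_Int_sphere)
    qed
    moreover have "range (\<lambda>i. radial_cone (E i) - {0}) \<subseteq> sets lebesgue"
      using E(1) by (auto simp: spherical_sets_def intro!: sets.Diff)
    ultimately have "(\<Sum>i. emeasure lebesgue (radial_cone (E i) - {0}))
        = emeasure lebesgue (radial_cone (\<Union>i. E i) - {0})"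
      unfolding UN by (intro suminf_emeasure)
    moreover have "E i \<in> spherical_sets" for i using E(1) by auto
    ultimately show "(\<Sum>i. ?m (E i)) = ?m (\<Union>i. E i)"
      by (simp add: eq E(3) ennreal_suminf_cmult)
  qed
qed (use assms sigma_algebra_spherical_sets in auto)

text \<open>Functions on the sphere are represented by functions on \<open>real^'n\<close>. Measurability, integrals
  and almost everywhere statements for \<^const>\<open>spherical_lebesgue\<close> depend only on the values on
  its space, the unit sphere, so the values elsewhere disappear in the quotient below.\<close>

definition Lp_fun :: "real \<Rightarrow> (real^'n \<Rightarrow> complex) set" where
  "Lp_fun p = {f. f \<in> borel_measurable spherical_lebesgue \<and>
                  integrable spherical_lebesgue (\<lambda>u. norm (f u) powr p)}"

definition Lp_norm :: "real \<Rightarrow> (real^'n \<Rightarrow> complex) \<Rightarrow> real" where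
  "Lp_norm p f = (\<integral>u. norm (f u) powr p \<partial>spherical_lebesgue) powr (1 / p)"

definition ae_eq :: "real \<Rightarrow> ((real^'n \<Rightarrow> complex) \<times> (real^'n \<Rightarrow> complex)) set" where
  "ae_eq p = {(f, g). f \<in> Lp_fun p \<and> g \<in> Lp_fun p \<and> (AE u in spherical_lebesgue. f u = g u)}"

lemma equiv_ae_eq: "equiv (Lp_fun p) (ae_eq p)"
proof (rule equivI)
  show "trans (ae_eq p :: ((real^'n \<Rightarrow> complex) \<times> _) set)"
    unfolding ae_eq_def by (rule transI) (auto elim: eventually_elim2)
qed (auto simp: ae_eq_def refl_on_def sym_def elim: eventually_mono)

text \<open>The \<open>L\<^sup>p\<close> space is the quotient \<open>Lp_fun p // ae_eq p\<close>; a function on it is a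
  \<open>\<Phi> :: (real^'n \<Rightarrow> complex) set \<Rightarrow> complex\<close>, of which only the values at the classes
  \<open>Lp_class p f\<close> with \<open>f \<in> Lp_fun p\<close> are ever referred to.\<close>

definition Lp_class :: "real \<Rightarrow> (real^'n \<Rightarrow> complex) \<Rightarrow> (real^'n \<Rightarrow> complex) set" where
  "Lp_class p f = ae_eq p `` {f}"

definition csup :: "('a \<Rightarrow> complex) \<Rightarrow> ('a \<Rightarrow> complex) \<Rightarrow> 'a \<Rightarrow> complex" where
  "csup f g = (\<lambda>u. Complex (max (Re (f u)) (Re (g u))) (max (Im (f u)) (Im (g u))))"

definition cinf :: "('a \<Rightarrow> complex) \<Rightarrow> ('a \<Rightarrow> complex) \<Rightarrow> 'a \<Rightarrow> complex" where
  "cinf f g = (\<lambda>u. Complex (min (Re (f u)) (Re (g u))) (min (Im (f u)) (Im (g u))))"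

definition Lp_valuation :: "real \<Rightarrow> ((real^'n \<Rightarrow> complex) set \<Rightarrow> complex) \<Rightarrow> bool" where
  "Lp_valuation p \<Phi> \<longleftrightarrow>
     (\<forall>f\<in>Lp_fun p. \<forall>g\<in>Lp_fun p.
        \<Phi> (Lp_class p (csup f g)) + \<Phi> (Lp_class p (cinf f g)) =
        \<Phi> (Lp_class p f) + \<Phi> (Lp_class p g)) \<and>
     \<Phi> (Lp_class p (\<lambda>u. 0)) = 0"

definition Lp_continuous :: "real \<Rightarrow> ((real^'n \<Rightarrow> complex) set \<Rightarrow> complex) \<Rightarrow> bool" where
  "Lp_continuous p \<Phi> \<longleftrightarrow>
     (\<forall>F f. (\<forall>i. F i \<in> Lp_fun p) \<longrightarrow> f \<in> Lp_fun p \<longrightarrow>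
        (\<lambda>i::nat. Lp_norm p (\<lambda>u. F i u - f u)) \<longlonglongrightarrow> 0 \<longrightarrow>
        (\<lambda>i. \<Phi> (Lp_class p (F i))) \<longlonglongrightarrow> \<Phi> (Lp_class p f))"

definition Lp_rotation_invariant :: "real \<Rightarrow> ((real^'n \<Rightarrow> complex) set \<Rightarrow> complex) \<Rightarrow> bool" where
  "Lp_rotation_invariant p \<Phi> \<longleftrightarrow>
     (\<forall>f\<in>Lp_fun p. \<forall>\<theta>. orthogonal_transformation \<theta> \<longrightarrow>
        \<Phi> (Lp_class p (f \<circ> inv \<theta>)) = \<Phi> (Lp_class p f))"

end

theory Submission
  imports Defs
begin

text \<open>
  The integral functionals are valuations because \<open>{max a b, min a b} = {a, b}\<close>, and their
  \<open>L\<^sup>p\<close>-continuity follows from dominated convergence along fast subsequences.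

  Conversely, the pairs \<open>f, 0\<close> and \<open>Re f, \<i> Im f\<close> have the same join and meet, so a valuation splits
  into four real ones, and a real valuation \<open>\<Psi>\<close> is additive on functions with disjoint supports. For
  fixed \<open>a\<close>, the set function mapping \<open>E\<close> to \<open>\<Psi>\<close> of \<open>a\<close> times the indicator of \<open>E\<close> is therefore
  additive, absolutely continuous with respect to spherical Lebesgue measure, and rotation invariant.
  Its positive and negative variations are measures whose Radon-Nikodym densities are rotation
  invariant, hence constant almost everywhere, so the set function is \<open>h a\<close> times spherical
  Lebesgue measure. This represents \<open>\<Psi>\<close> on simple functions, and continuity extends it to \<open>L\<^sup>p\<close>.
\<close>

section \<open>The variation of an absolutely continuous charge\<close>

text \<open>The analytic input is one consequence of continuity at 0: a real valuation is small on
  functions of small L^p norm. On multiples \<open>a * indicator E u\<close> with \<open>a\<close>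
  fixed, this is the absolute continuity that turns finite additivity into countable additivity of
  the variations; with \<open>a\<close> variable, it is the growth bound on \<open>h\<close>. Two
  obstacles shape the rest. The density is invariant under each rotation only off a null set
  depending on that rotation, so its constancy cannot be read off pointwise; reflections form a
  family indexed by vectors, and Fubini over this family produces one point that is good for almost
  all of them. The growth bound needs sets of arbitrarily small positive measure: on a two-point
  sphere, summing \<open>h\<close> over the two values gives a continuous invariant valuation for
  every continuous \<open>h\<close> with \<open>h 0 = 0\<close>, whatever its growth.
  \<open>CARD('n) \<ge> 2\<close> makes points null and thereby provides such sets.\<close>

definition upper_variation :: "'a measure \<Rightarrow> ('a set \<Rightarrow> real) \<Rightarrow> 'a set \<Rightarrow> real" where
  "upper_variation M \<nu> E = Sup (\<nu> ` {F \<in> sets M. F \<subseteq> E})"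

text \<open>A finitely additive charge whose Jordan parts are \<open>upper_variation M \<nu>\<close>
  and the same construction for \<open>- \<nu>\<close>. Absolute continuity later makes these parts
  countably additive; \<open>bounded\<close> keeps the real \<open>Sup\<close> in their definition
  meaningful.\<close>

locale abs_continuous_charge = finite_measure M for M :: "'a measure" +
  fixes \<nu> :: "'a set \<Rightarrow> real"
  assumes additive: "A \<in> sets M \<Longrightarrow> B \<in> sets M \<Longrightarrow> A \<inter> B = {} \<Longrightarrow> \<nu> (A \<union> B) = \<nu> A + \<nu> B"
    and abs_cont: "e > 0 \<Longrightarrow> \<exists>d>0. \<forall>A\<in>sets M. measure M A < d \<longrightarrow> \<bar>\<nu> A\<bar> < e"
    and bounded: "\<exists>C. \<forall>A\<in>sets M. \<bar>\<nu> A\<bar> \<le> C"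
begin

lemma empty [simp]: "\<nu> {} = 0"
  using additive[of "{}" "{}"] by simp

lemma bdd_above_subsets: "bdd_above (\<nu> ` {F \<in> sets M. F \<subseteq> E})"
proof -
  obtain C where "\<forall>A\<in>sets M. \<bar>\<nu> A\<bar> \<le> C" using bounded by blast
  then show ?thesis by (intro bdd_aboveI[of _ C]) force
qed

lemma upper_variation_ge:
  assumes "F \<in> sets M" "F \<subseteq> E"
  shows "\<nu> F \<le> upper_variation M \<nu> E"
  unfolding upper_variation_def using assms by (intro cSUP_upper bdd_above_subsets) auto

lemma upper_variation_nonneg: "0 \<le> upper_variation M \<nu> E"
  using upper_variation_ge[of "{}" E] by simp

lemma upper_variation_le:
  assumes "\<And>F. F \<in> sets M \<Longrightarrow> F \<subseteq> E \<Longrightarrow> \<nu> F \<le> c"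
  shows "upper_variation M \<nu> E \<le> c"
  unfolding upper_variation_def using assms by (intro cSUP_least) auto

text \<open>A measurable subset of the union splits into its traces on \<open>A\<close> and
  \<open>B\<close>; conversely, subsets of \<open>A\<close> and of \<open>B\<close> are disjoint and
  can be joined. In the second direction the two suprema are taken one after the other, with
  everything else moved to the right-hand side.\<close>

lemma upper_variation_union:
  assumes A: "A \<in> sets M" and B: "B \<in> sets M" and AB: "A \<inter> B = {}"
  shows "upper_variation M \<nu> (A \<union> B) = upper_variation M \<nu> A + upper_variation M \<nu> B"
proof (rule antisym)
  show "upper_variation M \<nu> (A \<union> B) \<le> upper_variation M \<nu> A + upper_variation M \<nu> B"
  proof (rule upper_variation_le)
    fix F assume F: "F \<in> sets M" "F \<subseteq> A \<union> B"
    have "\<nu> F = \<nu> ((F \<inter> A) \<union> (F \<inter> B))" using F(2) by (simp add: Int_Un_distrib[symmetric] Int_absorb2)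
    also have "\<dots> = \<nu> (F \<inter> A) + \<nu> (F \<inter> B)"
      using A B F AB by (intro additive) auto
    also have "\<dots> \<le> upper_variation M \<nu> A + upper_variation M \<nu> B"
      using A B F by (intro add_mono upper_variation_ge) auto
    finally show "\<nu> F \<le> upper_variation M \<nu> A + upper_variation M \<nu> B" .
  qed
  have "upper_variation M \<nu> A \<le> upper_variation M \<nu> (A \<union> B) - upper_variation M \<nu> B"
  proof (rule upper_variation_le)
    fix F assume F: "F \<in> sets M" "F \<subseteq> A"
    have "upper_variation M \<nu> B \<le> upper_variation M \<nu> (A \<union> B) - \<nu> F"
    proof (rule upper_variation_le)
      fix G assume G: "G \<in> sets M" "G \<subseteq> B"
      have "\<nu> F + \<nu> G = \<nu> (F \<union> G)" using F G AB by (intro additive[symmetric]) auto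
      also have "\<dots> \<le> upper_variation M \<nu> (A \<union> B)"
        using F G by (intro upper_variation_ge) auto
      finally show "\<nu> G \<le> upper_variation M \<nu> (A \<union> B) - \<nu> F" by simp
    qed
    then show "\<nu> F \<le> upper_variation M \<nu> (A \<union> B) - upper_variation M \<nu> B" by simp
  qed
  then show "upper_variation M \<nu> A + upper_variation M \<nu> B \<le> upper_variation M \<nu> (A \<union> B)" by simp
qed

lemma uminus: "abs_continuous_charge M (\<lambda>E. - \<nu> E)"
  by standard (use additive abs_cont bounded in auto)

text \<open>The Jordan decomposition. Since \<open>\<nu> F = \<nu> A + (- \<nu> (A - F))\<close>,
  and \<open>A - F\<close> runs through the measurable subsets of \<open>A\<close> when
  \<open>F\<close> does, the two suprema differ by exactly \<open>\<nu> A\<close>.\<close>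

lemma upper_variation_diff:
  assumes A: "A \<in> sets M"
  shows "\<nu> A = upper_variation M \<nu> A - upper_variation M (\<lambda>E. - \<nu> E) A"
proof -
  interpret neg: abs_continuous_charge M "\<lambda>E. - \<nu> E"
    by (rule uminus)
  have split: "\<nu> A = \<nu> F + \<nu> (A - F)" if "F \<in> sets M" "F \<subseteq> A" for F
    using additive[of F "A - F"] that A by (simp add: Un_absorb1)
  have "upper_variation M \<nu> A \<le> \<nu> A + upper_variation M (\<lambda>E. - \<nu> E) A"
  proof (rule upper_variation_le)
    fix F assume F: "F \<in> sets M" "F \<subseteq> A"
    then show "\<nu> F \<le> \<nu> A + upper_variation M (\<lambda>E. - \<nu> E) A"
      using split[OF F] neg.upper_variation_ge[of "A - F" A] A by simp
  qed
  moreover have "upper_variation M (\<lambda>E. - \<nu> E) A \<le> upper_variation M \<nu> A - \<nu> A"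
  proof (rule neg.upper_variation_le)
    fix F assume F: "F \<in> sets M" "F \<subseteq> A"
    then show "- \<nu> F \<le> upper_variation M \<nu> A - \<nu> A"
      using split[OF F] upper_variation_ge[of "A - F" A] A by simp
  qed
  ultimately show ?thesis by simp
qed

lemma upper_variation_abs_cont:
  assumes "e > 0"
  shows "\<exists>d>0. \<forall>A\<in>sets M. measure M A < d \<longrightarrow> upper_variation M \<nu> A \<le> e"
proof -
  obtain d where d: "d > 0" "\<And>A. A \<in> sets M \<Longrightarrow> measure M A < d \<Longrightarrow> \<bar>\<nu> A\<bar> < e"
    using abs_cont[OF assms] by blast
  have "upper_variation M \<nu> A \<le> e" if A: "A \<in> sets M" "measure M A < d" for A
  proof (rule upper_variation_le)
    fix F assume F: "F \<in> sets M" "F \<subseteq> A"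
    then have "measure M F < d" using A finite_measure_mono[of F A] by simp
    then show "\<nu> F \<le> e" using d(2)[OF F(1)] by simp
  qed
  then show ?thesis using d(1) by blast
qed

text \<open>A finite-valued additive set function is countably additive once it tends to 0 along
  decreasing sets with empty intersection. Along such sets the measure \<open>M\<close> tends to 0,
  hence so does the variation by absolute continuity, which also makes \<open>M\<close>-null sets
  null for \<open>N\<close>.\<close>

lemma upper_variation_measure:
  obtains N where "sets N = sets M" "finite_measure N" "absolutely_continuous M N"
    "\<And>A. A \<in> sets M \<Longrightarrow> emeasure N A = ennreal (upper_variation M \<nu> A)"
proof -
  let ?f = "\<lambda>A. ennreal (upper_variation M \<nu> A)"
  define N where "N = measure_of (space M) (sets M) ?f"
  have "upper_variation M \<nu> {} \<le> 0" by (rule upper_variation_le) simp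
  then have pos: "positive (sets M) ?f" by (simp add: positive_def ennreal_neg)
  have "countably_additive (sets M) ?f"
  proof (rule sets.empty_continuous_imp_countably_additive[OF pos])
    show "additive (sets M) ?f"
      by (simp add: Measure_Space.additive_def upper_variation_union upper_variation_nonneg)
    show "\<forall>A\<in>sets M. ?f A \<noteq> \<infinity>" by simp
  next
    fix A :: "nat \<Rightarrow> 'a set" assume A: "range A \<subseteq> sets M" "decseq A" "(\<Inter>i. A i) = {}"
    have lim: "(\<lambda>i. measure M (A i)) \<longlonglongrightarrow> 0"
      using finite_Lim_measure_decseq[OF A(1,2)] A(3) by simp
    have "(\<lambda>i. upper_variation M \<nu> (A i)) \<longlonglongrightarrow> 0"
    proof (rule LIMSEQ_I)
      fix e :: real assume "e > 0"
      \<comment> \<open>A supremum inherits only the nonstrict bound, so \<open>e / 2\<close> is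
        used to end strictly below \<open>e\<close>.\<close>
      then obtain d where d: "d > 0" "\<And>A. A \<in> sets M \<Longrightarrow> measure M A < d \<Longrightarrow> upper_variation M \<nu> A \<le> e / 2"
        using upper_variation_abs_cont[of "e / 2"] by auto
      obtain k where "\<And>i. i \<ge> k \<Longrightarrow> measure M (A i) < d"
        using order_tendstoD(2)[OF lim d(1)] by (auto simp: eventually_sequentially)
      then have "norm (upper_variation M \<nu> (A i) - 0) < e" if "i \<ge> k" for i
        using d(2)[of "A i"] A(1) that \<open>e > 0\<close> upper_variation_nonneg[of "A i"] by fastforce
      then show "\<exists>k. \<forall>i\<ge>k. norm (upper_variation M \<nu> (A i) - 0) < e" by blast
    qed
    then show "(\<lambda>i. ?f (A i)) \<longlonglongrightarrow> 0" using tendsto_ennrealI by fastforce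
  qed
  then have eN: "emeasure N A = ?f A" if "A \<in> sets M" for A
    unfolding N_def using pos that
    by (intro emeasure_measure_of_sigma sets.sigma_algebra_axioms) auto
  have sN: "sets N = sets M" by (simp add: N_def)
  have "finite_measure N"
    by standard (use eN[of "space M"] sN in \<open>simp add: sets_eq_imp_space_eq[OF sN]\<close>)
  moreover have "absolutely_continuous M N"
    unfolding absolutely_continuous_def
  proof
    fix A assume A: "A \<in> null_sets M"
    have "upper_variation M \<nu> A \<le> e" if "e > 0" for e
      using upper_variation_abs_cont[OF that] A by (auto simp: measure_eq_0_null_sets null_sets_def measure_def)
    then have "upper_variation M \<nu> A \<le> 0" by (rule field_le_epsilon[of _ 0, simplified])
    then show "A \<in> null_sets N" using A eN sN by (simp add: null_sets_def ennreal_neg)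
  qed
  ultimately show thesis using that eN sN by blast
qed

end

section \<open>Convergence of integrals in \<open>L\<^sup>p\<close>\<close>

definition Lp_space :: "'a measure \<Rightarrow> real \<Rightarrow> ('a \<Rightarrow> real) set" where
  "Lp_space M p = {f. f \<in> borel_measurable M \<and> integrable M (\<lambda>x. \<bar>f x\<bar> powr p)}"

definition power_growth :: "real \<Rightarrow> (real \<Rightarrow> real) \<Rightarrow> bool" where
  "power_growth p h \<longleftrightarrow> (\<exists>\<gamma>\<ge>0. \<exists>\<delta>\<ge>0. \<forall>a. \<bar>h a\<bar> \<le> \<gamma> * \<bar>a\<bar> powr p + \<delta>)"

lemma Lp_spaceD:
  assumes "f \<in> Lp_space M p"
  shows "f \<in> borel_measurable M" "integrable M (\<lambda>x. \<bar>f x\<bar> powr p)"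
  using assms by (auto simp: Lp_space_def)

text \<open>The sum is at most twice the larger term, whose power is one of the two powers on the
  right.\<close>

lemma abs_add_powr_le:
  fixes a b p :: real
  assumes "p \<ge> 0"
  shows "(\<bar>a\<bar> + \<bar>b\<bar>) powr p \<le> 2 powr p * (\<bar>a\<bar> powr p + \<bar>b\<bar> powr p)"
proof -
  have "(\<bar>a\<bar> + \<bar>b\<bar>) powr p \<le> (2 * max \<bar>a\<bar> \<bar>b\<bar>) powr p"
    using assms by (intro powr_mono2) auto
  also have "\<dots> = 2 powr p * max \<bar>a\<bar> \<bar>b\<bar> powr p"
    by (simp add: powr_mult)
  also have "\<dots> \<le> 2 powr p * (\<bar>a\<bar> powr p + \<bar>b\<bar> powr p)"
    by (intro mult_left_mono) (auto simp: max_def)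
  finally show ?thesis .
qed

text \<open>The membership test used throughout. Allowing two dominating functions covers sums,
  differences, maxima and minima at once.\<close>

lemma Lp_space_dominated:
  assumes "p \<ge> 0" and g[measurable]: "g \<in> borel_measurable M"
    and f1: "f1 \<in> Lp_space M p" and f2: "f2 \<in> Lp_space M p"
    and le: "\<And>x. x \<in> space M \<Longrightarrow> \<bar>g x\<bar> \<le> \<bar>f1 x\<bar> + \<bar>f2 x\<bar>"
  shows "g \<in> Lp_space M p"
proof -
  have "integrable M (\<lambda>x. 2 powr p * (\<bar>f1 x\<bar> powr p + \<bar>f2 x\<bar> powr p))"
    using Lp_spaceD[OF f1] Lp_spaceD[OF f2] by auto
  then have "integrable M (\<lambda>x. \<bar>g x\<bar> powr p)"
  proof (rule Bochner_Integration.integrable_bound)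
    show "AE x in M. norm (\<bar>g x\<bar> powr p) \<le> norm (2 powr p * (\<bar>f1 x\<bar> powr p + \<bar>f2 x\<bar> powr p))"
    proof (rule AE_I2)
      fix x assume x: "x \<in> space M"
      have "\<bar>g x\<bar> powr p \<le> (\<bar>f1 x\<bar> + \<bar>f2 x\<bar>) powr p"
        using le[OF x] assms(1) by (intro powr_mono2) auto
      also have "\<dots> \<le> 2 powr p * (\<bar>f1 x\<bar> powr p + \<bar>f2 x\<bar> powr p)"
        by (rule abs_add_powr_le[OF assms(1)])
      finally show "norm (\<bar>g x\<bar> powr p) \<le> norm (2 powr p * (\<bar>f1 x\<bar> powr p + \<bar>f2 x\<bar> powr p))"
        by simp
    qed
  qed simp
  then show ?thesis by (simp add: Lp_space_def)
qed

section \<open>Integral functionals and simple approximation over a finite measure\<close>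

context finite_measure
begin

lemma Lp_space_const: "(\<lambda>x. c) \<in> Lp_space M p"
  by (simp add: Lp_space_def)

lemma Lp_space_bounded:
  assumes "p \<ge> 0" "g \<in> borel_measurable M" "\<And>x. x \<in> space M \<Longrightarrow> \<bar>g x\<bar> \<le> c"
  shows "g \<in> Lp_space M p"
  by (rule Lp_space_dominated[OF assms(1,2) Lp_space_const[of c] Lp_space_const[of 0]])
     (use assms(3) in force)

lemma integrable_power_growth:
  fixes h :: "real \<Rightarrow> real"
  assumes f: "f \<in> Lp_space M p" and "continuous_on UNIV h" "power_growth p h"
  shows "integrable M (\<lambda>x. h (f x))"
proof -
  obtain \<gamma> \<delta> where h: "\<gamma> \<ge> 0" "\<delta> \<ge> 0" "\<And>a. \<bar>h a\<bar> \<le> \<gamma> * \<bar>a\<bar> powr p + \<delta>"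
    using assms(3) unfolding power_growth_def by blast
  note [measurable] = Lp_spaceD(1)[OF f] borel_measurable_continuous_onI[OF assms(2)]
  have "integrable M (\<lambda>x. \<gamma> * \<bar>f x\<bar> powr p + \<delta>)"
    using Lp_spaceD[OF f] by simp
  then show ?thesis
    by (rule Bochner_Integration.integrable_bound)
       (use h in \<open>auto intro!: AE_I2 order_trans[OF h(3)]\<close>)
qed

text \<open>For a fast sequence, the sum of all \<open>\<bar>G i x - f x\<bar> powr p\<close> is integrable, which gives both
  almost everywhere convergence and a dominating function.\<close>

lemma tendsto_integral_power_growth_fast:
  fixes h :: "real \<Rightarrow> real"
  assumes p: "p > 0" and h: "continuous_on UNIV h" "power_growth p h"
    and G: "\<And>i. G i \<in> Lp_space M p" and f: "f \<in> Lp_space M p"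
    and fast: "\<And>i. (\<integral>x. \<bar>G i x - f x\<bar> powr p \<partial>M) \<le> (1 / 2) ^ i"
  shows "(\<lambda>i. \<integral>x. h (G i x) \<partial>M) \<longlonglongrightarrow> (\<integral>x. h (f x) \<partial>M)"
proof -
  obtain \<gamma> \<delta> where \<gamma>\<delta>: "\<gamma> \<ge> 0" "\<delta> \<ge> 0" "\<And>a. \<bar>h a\<bar> \<le> \<gamma> * \<bar>a\<bar> powr p + \<delta>"
    using h(2) unfolding power_growth_def by blast
  note [measurable] = Lp_spaceD(1)[OF f] Lp_spaceD(1)[OF G] borel_measurable_continuous_onI[OF h(1)]
  define d where "d i x = \<bar>G i x - f x\<bar> powr p" for i x
  have [measurable]: "d i \<in> borel_measurable M" for i unfolding d_def by measurable
  have d_nonneg: "d i x \<ge> 0" for i x by (simp add: d_def)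
  have int_d: "integrable M (d i)" for i
  proof -
    have "(\<lambda>x. G i x - f x) \<in> Lp_space M p"
      by (rule Lp_space_dominated[OF _ _ G[of i] f]) (use p in auto)
    then show ?thesis by (simp add: Lp_space_def d_def[abs_def])
  qed
  have sum_fast: "summable (\<lambda>i. \<integral>x. norm (d i x) \<partial>M)"
    by (rule summable_comparison_test'[of "\<lambda>i. (1 / 2) ^ i"])
       (use fast in \<open>auto simp: d_def\<close>)
  have AE_sum: "AE x in M. summable (\<lambda>i. norm (d i x))"
  proof -
    have "(\<integral>\<^sup>+x. (\<Sum>i. ennreal (d i x)) \<partial>M) = (\<Sum>i. \<integral>\<^sup>+x. ennreal (d i x) \<partial>M)"
      by (rule nn_integral_suminf) measurable
    also have "\<dots> = (\<Sum>i. ennreal (\<integral>x. d i x \<partial>M))"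
      using int_d d_nonneg by (subst nn_integral_eq_integral) auto
    also have "\<dots> = ennreal (\<Sum>i. \<integral>x. d i x \<partial>M)"
      using sum_fast d_nonneg by (intro suminf_ennreal2) auto
    finally have "(\<integral>\<^sup>+x. (\<Sum>i. ennreal (d i x)) \<partial>M) \<noteq> \<infinity>" by simp
    then have "AE x in M. (\<Sum>i. ennreal (d i x)) \<noteq> \<infinity>"
      by (intro nn_integral_PInf_AE) auto
    then show ?thesis
      by (rule eventually_mono) (use d_nonneg in \<open>auto intro!: summable_suminf_not_top\<close>)
  qed
  have S: "integrable M (\<lambda>x. \<Sum>i. d i x)"
    by (rule integrable_suminf[OF int_d AE_sum sum_fast])
  have bound: "AE x in M. norm (h (G i x)) \<le> \<gamma> * (2 powr p * ((\<Sum>i. d i x) + \<bar>f x\<bar> powr p)) + \<delta>" for i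
    using AE_sum
  proof (rule eventually_mono)
    fix x assume "summable (\<lambda>i. norm (d i x))"
    then have "d i x \<le> (\<Sum>i. d i x)"
      using d_nonneg sum_le_suminf[of "\<lambda>i. d i x" "{i}"] by auto
    have "\<bar>G i x\<bar> powr p \<le> (\<bar>G i x - f x\<bar> + \<bar>f x\<bar>) powr p"
      using p by (intro powr_mono2) auto
    also have "\<dots> \<le> 2 powr p * (d i x + \<bar>f x\<bar> powr p)"
      unfolding d_def using p by (intro abs_add_powr_le) auto
    also have "\<dots> \<le> 2 powr p * ((\<Sum>i. d i x) + \<bar>f x\<bar> powr p)"
      using \<open>d i x \<le> _\<close> by (intro mult_left_mono) auto
    finally have "\<gamma> * \<bar>G i x\<bar> powr p \<le> \<gamma> * (2 powr p * ((\<Sum>i. d i x) + \<bar>f x\<bar> powr p))"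
      using \<gamma>\<delta>(1) by (rule mult_left_mono)
    then show "norm (h (G i x)) \<le> \<gamma> * (2 powr p * ((\<Sum>i. d i x) + \<bar>f x\<bar> powr p)) + \<delta>"
      using \<gamma>\<delta>(3)[of "G i x"] by simp
  qed
  have lim: "AE x in M. (\<lambda>i. h (G i x)) \<longlonglongrightarrow> h (f x)"
    using AE_sum
  proof (rule eventually_mono)
    fix x assume "summable (\<lambda>i. norm (d i x))"
    then have "(\<lambda>i. d i x) \<longlonglongrightarrow> 0" using summable_LIMSEQ_zero d_nonneg by fastforce
    then have "(\<lambda>i. d i x powr (1 / p)) \<longlonglongrightarrow> 0 powr (1 / p)"
      using p d_nonneg by (intro tendsto_powr') auto
    then have "(\<lambda>i. \<bar>G i x - f x\<bar>) \<longlonglongrightarrow> 0" using p by (simp add: d_def powr_powr)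
    then have "(\<lambda>i. G i x) \<longlonglongrightarrow> f x"
      by (metis LIM_zero_cancel tendsto_rabs_zero_iff)
    then show "(\<lambda>i. h (G i x)) \<longlonglongrightarrow> h (f x)"
      using h(1) by (metis UNIV_I continuous_on_eq_continuous_at isCont_tendsto_compose open_UNIV)
  qed
  show ?thesis
    using S Lp_spaceD(2)[OF f] bound lim
    by (intro integral_dominated_convergence[where w = "\<lambda>x. \<gamma> * (2 powr p * ((\<Sum>i. d i x) + \<bar>f x\<bar> powr p)) + \<delta>"]) auto
qed

text \<open>If convergence failed, infinitely many integrals would stay at distance \<open>e\<close>
  from the limit, and among these a fast sequence can be picked, contradicting the fast case. The
  picked sequence \<open>F (n i)\<close> is treated as a sequence in its own right; its indices are
  not arranged to increase.\<close>

lemma tendsto_integral_power_growth: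
  fixes h :: "real \<Rightarrow> real"
  assumes p: "p > 0" and h: "continuous_on UNIV h" "power_growth p h"
    and F: "\<And>i. F i \<in> Lp_space M p" and f: "f \<in> Lp_space M p"
    and lim: "(\<lambda>i. \<integral>x. \<bar>F i x - f x\<bar> powr p \<partial>M) \<longlonglongrightarrow> 0"
  shows "(\<lambda>i. \<integral>x. h (F i x) \<partial>M) \<longlonglongrightarrow> (\<integral>x. h (f x) \<partial>M)"
proof (rule ccontr)
  assume "\<not> ?thesis"
  then obtain e where e: "e > 0" "\<And>N. \<exists>n\<ge>N. \<not> norm ((\<integral>x. h (F n x) \<partial>M) - (\<integral>x. h (f x) \<partial>M)) < e"
    unfolding LIMSEQ_iff by blast
  have "\<exists>n. (\<integral>x. \<bar>F n x - f x\<bar> powr p \<partial>M) \<le> (1 / 2) ^ i \<and>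
      \<not> norm ((\<integral>x. h (F n x) \<partial>M) - (\<integral>x. h (f x) \<partial>M)) < e" for i
  proof -
    obtain N where "\<And>n. n \<ge> N \<Longrightarrow> (\<integral>x. \<bar>F n x - f x\<bar> powr p \<partial>M) < (1 / 2) ^ i"
      using order_tendstoD(2)[OF lim, of "(1 / 2) ^ i"] by (auto simp: eventually_sequentially)
    then show ?thesis using e(2)[of N] by (meson less_imp_le)
  qed
  then obtain n where n: "\<And>i. (\<integral>x. \<bar>F (n i) x - f x\<bar> powr p \<partial>M) \<le> (1 / 2) ^ i"
      "\<And>i. \<not> norm ((\<integral>x. h (F (n i) x) \<partial>M) - (\<integral>x. h (f x) \<partial>M)) < e" by metis
  have "(\<lambda>i. \<integral>x. h (F (n i) x) \<partial>M) \<longlonglongrightarrow> (\<integral>x. h (f x) \<partial>M)"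
    by (rule tendsto_integral_power_growth_fast[OF p h F f n(1)])
  then obtain k where "norm ((\<integral>x. h (F (n k) x) \<partial>M) - (\<integral>x. h (f x) \<partial>M)) < e"
    using LIMSEQ_D[OF _ e(1)] by blast
  then show False using n(2) by blast
qed

lemma Lp_space_simple_approx:
  assumes p: "p > 0" and f: "f \<in> Lp_space M p"
  obtains F where "\<And>i. simple_function M (F i)" "\<And>i. F i \<in> Lp_space M p"
    "(\<lambda>i. \<integral>x. \<bar>F i x - f x\<bar> powr p \<partial>M) \<longlonglongrightarrow> 0"
proof -
  note [measurable] = Lp_spaceD(1)[OF f]
  obtain F where F: "\<And>i. simple_function M (F i)" "\<And>x. x \<in> space M \<Longrightarrow> (\<lambda>i. F i x) \<longlonglongrightarrow> f x"
    "\<And>i x. x \<in> space M \<Longrightarrow> \<bar>F i x\<bar> \<le> 2 * \<bar>f x\<bar>"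
    using borel_measurable_implies_sequence_metric[OF Lp_spaceD(1)[OF f], of 0]
    by (simp add: dist_real_def) metis
  have [measurable]: "F i \<in> borel_measurable M" for i
    using F(1) by (rule borel_measurable_simple_function)
  have FL: "F i \<in> Lp_space M p" for i
    by (rule Lp_space_dominated[OF _ _ f f]) (use p F(3) in force)+
  \<comment> \<open>The approximants are controlled relative to the base point 0, which gives
    \<open>\<bar>F i x\<bar> \<le> 2 * \<bar>f x\<bar>\<close>; with the triangle inequality this is
    the factor 3 in the dominating function.\<close>
  have "(\<lambda>i. \<integral>x. \<bar>F i x - f x\<bar> powr p \<partial>M) \<longlonglongrightarrow> (\<integral>x. 0 \<partial>M)"
  proof (rule integral_dominated_convergence[where w = "\<lambda>x. 3 powr p * \<bar>f x\<bar> powr p"])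
    show "integrable M (\<lambda>x. 3 powr p * \<bar>f x\<bar> powr p)" using Lp_spaceD(2)[OF f] by simp
    show "AE x in M. (\<lambda>i. \<bar>F i x - f x\<bar> powr p) \<longlonglongrightarrow> 0"
    proof (rule AE_I2)
      fix x assume "x \<in> space M"
      then have "(\<lambda>i. \<bar>F i x - f x\<bar>) \<longlonglongrightarrow> 0" using F(2) by (simp add: LIM_zero tendsto_rabs_zero)
      then have "(\<lambda>i. \<bar>F i x - f x\<bar> powr p) \<longlonglongrightarrow> 0 powr p"
        using p by (intro tendsto_powr') auto
      then show "(\<lambda>i. \<bar>F i x - f x\<bar> powr p) \<longlonglongrightarrow> 0" by simp
    qed
    show "AE x in M. norm (\<bar>F i x - f x\<bar> powr p) \<le> 3 powr p * \<bar>f x\<bar> powr p" for i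
    proof (rule AE_I2)
      fix x assume "x \<in> space M"
      then have "\<bar>F i x - f x\<bar> powr p \<le> (3 * \<bar>f x\<bar>) powr p"
        using p F(3)[of x i] by (intro powr_mono2) auto
      then show "norm (\<bar>F i x - f x\<bar> powr p) \<le> 3 powr p * \<bar>f x\<bar> powr p"
        by (simp add: powr_mult)
    qed
  qed auto
  then show thesis using that[OF F(1) FL] by simp
qed

end

section \<open>Spherical Lebesgue measure\<close>

text \<open>The exceptional set need not be Borel, so the passage goes through the completion.
  Negligibility is the form in which exceptional sets can be moved by linear and differentiable
  maps.\<close>

lemma AE_lborel_iff_negligible: "(AE x in lborel. P x) \<longleftrightarrow> negligible {x. \<not> P x}"
proof -
  have "(AE x in lborel. P x) \<longleftrightarrow> (AE x in lebesgue. P x)"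
    by (simp add: AE_completion_iff)
  also have "\<dots> \<longleftrightarrow> negligible {x. \<not> P x}"
  proof
    assume "AE x in lebesgue. P x"
    then obtain N where N: "\<And>x. x \<in> space lebesgue - N \<Longrightarrow> P x" "N \<in> null_sets lebesgue"
      using AE_E3 by blast
    then have "{x. \<not> P x} \<subseteq> N" by auto
    then show "negligible {x. \<not> P x}"
      using N(2) negligible_iff_null_sets negligible_subset by blast
  next
    assume "negligible {x. \<not> P x}"
    then have "{x. \<not> P x} \<in> null_sets lebesgue"
      by (simp only: negligible_iff_null_sets)
    then show "AE x in lebesgue. P x"
      by (rule AE_I') simp
  qed
  finally show ?thesis .
qed

text \<open>The library has rotation invariance of Lebesgue measure (\<open>measure_orthogonal_image\<close>) only
  for \<open>real^'n\<close> with a well-ordered index type. Here it follows from uniqueness of translation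
  invariant measures: Fubini for \<open>indicator A x * indicator B (x - y)\<close> shows that the image measure
  is a multiple of \<open>lborel\<close>, and the unit ball \<open>B\<close> fixes the factor.\<close>

lemma distr_orthogonal_lborel:
  fixes \<theta> :: "'a::euclidean_space \<Rightarrow> 'a"
  assumes "orthogonal_transformation \<theta>"
  shows "distr lborel borel \<theta> = lborel"
proof -
  have lin: "linear \<theta>" and nrm: "norm (\<theta> x) = norm x" and surj: "surj \<theta>" for x
    using assms orthogonal_transformation_linear orthogonal_transformation_norm orthogonal_transformation_surj
    by blast+
  have [measurable]: "\<theta> \<in> borel_measurable borel"
    using lin by (simp add: borel_measurable_continuous_onI linear_continuous_on linear_linear)
  define N where "N = distr lborel borel \<theta>"
  have [measurable_cong]: "sets N = sets borel" by (simp add: N_def)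
  define B where "B = ball (0::'a) 1"
  have [measurable]: "B \<in> sets borel" by (simp add: B_def)
  have "N B = emeasure lborel (\<theta> -` B)"
    by (simp add: N_def emeasure_distr)
  also have "\<theta> -` B = B" using nrm by (auto simp: B_def)
  finally have NB: "N B = emeasure lborel B" .
  have ball_pos: "emeasure lborel B \<noteq> 0" "emeasure lborel B \<noteq> \<infinity>"
    using emeasure_lborel_ball_finite[of "0::'a" 1] open_not_negligible[of B]
    by (auto simp: B_def negligible_iff_null_sets null_sets_def)
  \<comment> \<open>Translating the target by \<open>\<theta> z\<close> amounts to translating the
    source by \<open>z\<close>, and surjectivity makes every \<open>y\<close> of the form
    \<open>\<theta> z\<close>.\<close>
  have trans: "(\<integral>\<^sup>+x. g (x + y) \<partial>N) = (\<integral>\<^sup>+x. g x \<partial>N)" if [measurable]: "g \<in> borel_measurable borel" for g y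
  proof -
    obtain z where z: "y = \<theta> z" using surj by blast
    have "(\<integral>\<^sup>+x. g (x + y) \<partial>N) = (\<integral>\<^sup>+x. g (\<theta> (z + x)) \<partial>lborel)"
      by (simp add: N_def nn_integral_distr z linear_add[OF lin] add.commute)
    also have "\<dots> = (\<integral>\<^sup>+x. g (\<theta> x) \<partial>distr lborel borel ((+) z))"
      by (simp add: nn_integral_distr)
    also have "\<dots> = (\<integral>\<^sup>+x. g x \<partial>N)"
      by (simp only: lborel_distr_plus) (simp add: N_def nn_integral_distr)
    finally show ?thesis .
  qed
  \<comment> \<open>Centred balls are their own preimages, so they have finite
    \<open>N\<close>-measure; this is the sigma-finiteness that Fubini requires.\<close>
  have fin: "N (ball 0 r) < \<infinity>" for r
  proof -
    have "N (ball 0 r) = emeasure lborel (\<theta> -` ball 0 r)"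
      by (simp add: N_def emeasure_distr)
    also have "\<theta> -` ball 0 r = ball 0 r" using nrm by auto
    finally show ?thesis using emeasure_lborel_ball_finite[of 0 r] by simp
  qed
  interpret N: sigma_finite_measure N
  proof
    show "\<exists>A. countable A \<and> A \<subseteq> sets N \<and> \<Union>A = space N \<and> (\<forall>a\<in>A. emeasure N a \<noteq> \<infinity>)"
    proof (intro exI[of _ "range (\<lambda>i::nat. ball (0::'a) (real i))"] conjI)
      show "\<Union>(range (\<lambda>i::nat. ball (0::'a) (real i))) = space N"
        by (auto simp: N_def reals_Archimedean2)
    qed (use fin in \<open>auto simp: less_top\<close>)
  qed
  interpret P: pair_sigma_finite N lborel ..
  have "emeasure N A = emeasure lborel A" if [measurable]: "A \<in> sets borel" for A
  proof -
    define F :: "'a \<Rightarrow> 'a \<Rightarrow> ennreal" where "F = (\<lambda>x y. indicator A x * indicator B (x - y))"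
    have [measurable]: "case_prod F \<in> borel_measurable (N \<Otimes>\<^sub>M lborel)"
      unfolding F_def by measurable
    define G :: "'a \<Rightarrow> 'a \<Rightarrow> ennreal" where "G = (\<lambda>x y. indicator B x * indicator A (x + y))"
    have [measurable]: "case_prod G \<in> borel_measurable (N \<Otimes>\<^sub>M lborel)"
      unfolding G_def by measurable
    have shift: "(\<integral>\<^sup>+y. g (x + y) \<partial>lborel) = (\<integral>\<^sup>+y. g y \<partial>lborel)" if [measurable]: "g \<in> borel_measurable borel" 
      for g :: "'a \<Rightarrow> ennreal" and x
      by (subst (2) lborel_distr_plus[symmetric, of x]) (simp add: nn_integral_distr)
    have "(\<integral>\<^sup>+x. \<integral>\<^sup>+y. F x y \<partial>lborel \<partial>N) = (\<integral>\<^sup>+x. indicator A x * emeasure lborel B \<partial>N)"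
    proof (rule nn_integral_cong)
      \<comment> \<open>The ball is symmetric, so \<open>x - y\<close> may be replaced by
        \<open>- x + y\<close>, a translate in \<open>y\<close>.\<close>
      fix x
      have "(\<integral>\<^sup>+y. indicator B (x - y) \<partial>lborel) = (\<integral>\<^sup>+y. indicator B (- x + y) \<partial>lborel)"
        by (intro nn_integral_cong) (auto simp: indicator_def B_def norm_minus_commute)
      also have "\<dots> = emeasure lborel B"
        by (subst shift) auto
      finally show "(\<integral>\<^sup>+y. F x y \<partial>lborel) = indicator A x * emeasure lborel B"
        unfolding F_def by (subst nn_integral_cmult) auto
    qed
    also have "\<dots> = emeasure N A * emeasure lborel B"
      by (subst nn_integral_multc) auto
    finally have 1: "(\<integral>\<^sup>+x. \<integral>\<^sup>+y. F x y \<partial>lborel \<partial>N) = emeasure N A * emeasure lborel B" .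
    have "(\<integral>\<^sup>+x. \<integral>\<^sup>+y. F x y \<partial>lborel \<partial>N) = (\<integral>\<^sup>+y. \<integral>\<^sup>+x. F x y \<partial>N \<partial>lborel)"
      by (rule P.Fubini'[symmetric]) measurable
    also have "\<dots> = (\<integral>\<^sup>+y. \<integral>\<^sup>+x. G x y \<partial>N \<partial>lborel)"
    proof (rule nn_integral_cong)
      \<comment> \<open>For fixed \<open>y\<close>, translation invariance of \<open>N\<close>
        replaces \<open>x\<close> by \<open>x + y\<close>; this moves the shift from
        \<open>B\<close> to \<open>A\<close> and turns \<open>F\<close> into
        \<open>G\<close>.\<close>
      fix y
      show "(\<integral>\<^sup>+x. F x y \<partial>N) = (\<integral>\<^sup>+x. G x y \<partial>N)"
        using trans[of "\<lambda>x. F x y" y] by (simp add: F_def G_def mult.commute)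
    qed
    also have "\<dots> = (\<integral>\<^sup>+x. \<integral>\<^sup>+y. G x y \<partial>lborel \<partial>N)"
      by (rule P.Fubini') measurable
    also have "\<dots> = (\<integral>\<^sup>+x. indicator B x * emeasure lborel A \<partial>N)"
    proof (rule nn_integral_cong)
      fix x
      have "(\<integral>\<^sup>+y. indicator A (x + y) \<partial>lborel) = emeasure lborel A"
        by (subst shift) auto
      then show "(\<integral>\<^sup>+y. G x y \<partial>lborel) = indicator B x * emeasure lborel A"
        unfolding G_def by (subst nn_integral_cmult) auto
    qed
    also have "\<dots> = emeasure lborel A * emeasure lborel B"
      by (subst nn_integral_multc) (auto simp: NB mult.commute)
    finally have "emeasure N A * emeasure lborel B = emeasure lborel A * emeasure lborel B"
      using 1 by simp
    then show ?thesis
      using ball_pos by (metis ennreal_mult_divide_eq infinity_ennreal_def)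
  qed
  then have "N = lborel" by (intro measure_eqI) (auto simp: N_def)
  then show ?thesis by (simp add: N_def)
qed

text \<open>By \<open>measure_linear_sufficient\<close> with factor 1 it is enough to treat boxes. A
  box is Borel, and its image under \<open>\<theta>\<close> is its preimage under
  \<open>inv \<theta>\<close>, so invariance of \<open>lborel\<close> under
  \<open>inv \<theta>\<close> gives the value.\<close>

lemma orthogonal_image_lmeasurable:
  fixes \<theta> :: "'a::euclidean_space \<Rightarrow> 'a"
  assumes "orthogonal_transformation \<theta>" "S \<in> lmeasurable"
  shows "\<theta> ` S \<in> lmeasurable" "measure lebesgue (\<theta> ` S) = measure lebesgue S"
proof -
  have lin: "linear \<theta>" and bij: "bij \<theta>"
    using assms orthogonal_transformation_linear orthogonal_transformation_bij by blast+
  define \<eta> where "\<eta> = inv \<theta>"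
  have \<eta>: "orthogonal_transformation \<eta>"
    unfolding \<eta>_def by (rule orthogonal_transformation_inv[OF assms(1)])
  have [measurable]: "\<eta> \<in> borel_measurable borel"
    using orthogonal_transformation_linear[OF \<eta>] 
    by (simp add: borel_measurable_continuous_onI linear_continuous_on linear_linear)
  have "measure lebesgue (\<theta> ` cbox a b) = measure lebesgue (cbox a b)" for a b
  proof -
    have "\<theta> ` cbox a b = \<eta> -` cbox a b"
      unfolding \<eta>_def by (rule bij_image_Collect_eq[OF bij, of "\<lambda>x. x \<in> cbox a b", simplified, folded vimage_def])
    moreover have "emeasure lborel (\<eta> -` cbox a b) = emeasure (distr lborel borel \<eta>) (cbox a b)"
      by (subst emeasure_distr) auto
    moreover have "\<eta> -` cbox a b \<in> sets borel"
      using measurable_sets[of \<eta> borel borel "cbox a b"] by simp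
    ultimately show ?thesis
      using distr_orthogonal_lborel[OF \<eta>] by (simp add: measure_def)
  qed
  then show "\<theta> ` S \<in> lmeasurable" "measure lebesgue (\<theta> ` S) = measure lebesgue S"
    using measure_linear_sufficient[OF lin assms(2), of 1] by auto
qed

section \<open>Cones, null sets and symmetries of the sphere\<close>

lemma radial_cone_minus_zero:
  fixes E :: "(real^'n) set"
  assumes "E \<subseteq> sphere 0 1"
  shows "radial_cone E - {0} = {x. x \<noteq> 0 \<and> norm x \<le> 1 \<and> x /\<^sub>R norm x \<in> E}"
  using radial_cone_Int_sphere[OF assms] by auto

text \<open>The measure of \<open>E\<close> is a positive multiple of the volume of its cone, and
  the apex does not affect negligibility. The punctured cone is used because it has the pointwise
  description of \<open>radial_cone_minus_zero\<close>.\<close>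

lemma null_sets_spherical_lebesgue_iff:
  fixes E :: "(real^'n) set"
  assumes "E \<subseteq> sphere 0 1"
  shows "E \<in> null_sets spherical_lebesgue \<longleftrightarrow> negligible (radial_cone E - {0})"
proof -
  have "negligible (radial_cone E - {0}) \<longleftrightarrow> negligible (radial_cone E)"
    by (metis negligible_insert insert_Diff_single)
  also have "\<dots> \<longleftrightarrow> E \<in> null_sets spherical_lebesgue"
    using assms emeasure_spherical_lebesgue[of E]
    by (auto simp: null_sets_def sets_spherical_lebesgue negligible_iff_null_sets spherical_sets_def)
  finally show ?thesis by simp
qed

text \<open>Moves exceptional sets from the sphere to the punctured ball, where Fubini and images
  under differentiable maps are available.\<close>

lemma AE_spherical_lebesgue_iff:
  fixes P :: "real^'n \<Rightarrow> bool"
  shows "(AE u in spherical_lebesgue. P u) \<longleftrightarrow>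
    negligible {x. x \<noteq> 0 \<and> norm x \<le> 1 \<and> \<not> P (x /\<^sub>R norm x)}"
proof -
  define E where "E = {u \<in> sphere 0 1. \<not> P u}"
  have sub: "E \<subseteq> sphere 0 1" by (auto simp: E_def)
  have "radial_cone E - {0} = {x. x \<noteq> 0 \<and> norm x \<le> 1 \<and> \<not> P (x /\<^sub>R norm x)}"
    unfolding radial_cone_minus_zero[OF sub] by (auto simp: E_def)
  moreover have "(AE u in spherical_lebesgue. P u) \<longleftrightarrow> E \<in> null_sets spherical_lebesgue"
  proof
    assume "AE u in spherical_lebesgue. P u"
    then obtain N where N: "N \<in> null_sets spherical_lebesgue" "E \<subseteq> N"
      unfolding E_def by (auto elim: AE_E3 simp: AE_iff_null_sets eventually_ae_filter)
    have "N \<subseteq> sphere 0 1" using N(1) sets.sets_into_space[of N spherical_lebesgue] by auto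
    then have "negligible (radial_cone N - {0})"
      using N(1) by (simp add: null_sets_spherical_lebesgue_iff)
    then have "negligible (radial_cone E - {0})"
      by (rule negligible_subset) (use N(2) in \<open>auto simp: radial_cone_def\<close>)
    then show "E \<in> null_sets spherical_lebesgue"
      using null_sets_spherical_lebesgue_iff sub by blast
  next
    assume "E \<in> null_sets spherical_lebesgue"
    then show "AE u in spherical_lebesgue. P u"
      by (rule AE_I') (auto simp: E_def)
  qed
  ultimately show ?thesis
    using null_sets_spherical_lebesgue_iff[OF sub] by simp
qed

lemma radial_cone_sphere: "radial_cone (sphere 0 1 :: (real^'n) set) = cball 0 1"
proof -
  \<comment> \<open>The apex belongs to the cone only because the sphere has a point to be scaled by
    0; a coordinate vector serves.\<close>
  have "(0::real^'n) \<in> radial_cone (sphere 0 1)"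
    unfolding radial_cone_def by (auto intro!: exI[of _ 0] exI[of _ "axis undefined 1"])
  moreover have "x \<in> radial_cone (sphere 0 1) \<longleftrightarrow> x \<in> cball 0 1" if "x \<noteq> 0" for x :: "real^'n"
    using that by (auto simp: radial_cone_Int_sphere)
  ultimately show ?thesis by (metis centre_in_cball order_antisym_conv subsetI zero_le_one)
qed

text \<open>Radial projection is Borel, and the preimage of \<open>E\<close> within the punctured
  ball is the punctured cone.\<close>

lemma sets_spherical_lebesgueI:
  fixes E :: "(real^'n) set"
  assumes "E \<subseteq> sphere 0 1" "E \<in> sets borel"
  shows "E \<in> sets spherical_lebesgue"
proof -
  have "(\<lambda>x::real^'n. x /\<^sub>R norm x) \<in> borel_measurable borel" by measurable
  then have "(\<lambda>x::real^'n. x /\<^sub>R norm x) -` E \<in> sets borel"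
    using measurable_sets[OF _ assms(2), of "\<lambda>x. x /\<^sub>R norm x" borel] by simp
  then have "(\<lambda>x::real^'n. x /\<^sub>R norm x) -` E \<inter> (cball 0 1 - {0}) \<in> sets borel"
    by (intro sets.Int sets.Diff) auto
  moreover have "(\<lambda>x. x /\<^sub>R norm x) -` E \<inter> (cball 0 1 - {0}) = radial_cone E - {0}"
    unfolding radial_cone_minus_zero[OF assms(1)] by auto
  ultimately have "radial_cone E - {0} \<in> sets lebesgue" by simp
  then show ?thesis
    using assms(1) lebesgue_insert_zero_iff by (auto simp: sets_spherical_lebesgue spherical_sets_def)
qed

lemma finite_measure_spherical_lebesgue:
  "finite_measure (spherical_lebesgue :: (real^'n) measure)"
proof
  have "sphere 0 1 \<in> (spherical_sets :: (real^'n) set set)"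
    using sets.top[of spherical_lebesgue] by (simp add: sets_spherical_lebesgue)
  then show "emeasure spherical_lebesgue (space (spherical_lebesgue :: (real^'n) measure)) \<noteq> \<infinity>"
    using emeasure_lborel_cball_finite[of "0::real^'n" 1]
    by (auto simp: emeasure_spherical_lebesgue radial_cone_sphere ennreal_mult_eq_top_iff)
qed

interpretation spherical: finite_measure "spherical_lebesgue :: (real^'n) measure"
  by (rule finite_measure_spherical_lebesgue)

lemma measure_sphere_pos: "0 < measure spherical_lebesgue (sphere 0 1 :: (real^'n) set)"
proof -
  have "\<not> negligible (radial_cone (sphere 0 1 :: (real^'n) set) - {0})"
  proof
    assume "negligible (radial_cone (sphere 0 1 :: (real^'n) set) - {0})"
    then have "negligible (insert 0 (radial_cone (sphere 0 1 :: (real^'n) set) - {0}))"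
      by (simp only: negligible_insert)
    then have "negligible (ball 0 1 :: (real^'n) set)"
      by (rule negligible_subset) (auto simp: radial_cone_sphere)
    then show False using open_not_negligible[of "ball 0 1 :: (real^'n) set"] by simp
  qed
  then have "sphere 0 1 \<notin> null_sets (spherical_lebesgue :: (real^'n) measure)"
    using null_sets_spherical_lebesgue_iff by blast
  then have "emeasure spherical_lebesgue (sphere 0 1 :: (real^'n) set) \<noteq> 0"
    using sets.top[of "spherical_lebesgue :: (real^'n) measure"] by (simp add: null_sets_def)
  then show ?thesis by (simp add: spherical.emeasure_eq_measure zero_less_measure_iff)
qed

text \<open>The cone over a point lies in a line, which is negligible in dimension at least
  two.\<close>

lemma singleton_null_spherical_lebesgue:
  fixes x :: "real^'n"
  assumes "CARD('n) \<ge> 2" "norm x = 1"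
  shows "{x} \<in> null_sets spherical_lebesgue"
proof -
  have "negligible (span {x})"
    by (rule negligible_lowdim) (use assms dim_le_card'[of "{x}"] in simp)
  then have "negligible (radial_cone {x} - {0})"
    by (rule negligible_subset) (auto simp: radial_cone_def span_singleton)
  then show ?thesis using assms by (subst null_sets_spherical_lebesgue_iff) auto
qed

text \<open>The preimage of \<open>E\<close> under \<open>\<theta>\<close> is its image under
  \<open>inv \<theta>\<close>, and forming cones commutes with linear maps, so everything reduces to
  volumes of cones. These are bounded, hence of finite measure as required by
  \<open>orthogonal_image_lmeasurable\<close>.\<close>

lemma orthogonal_spherical:
  fixes \<theta> :: "real^'n \<Rightarrow> real^'n"
  assumes "orthogonal_transformation \<theta>"
  shows measurable_orthogonal_spherical: "\<theta> \<in> measurable spherical_lebesgue spherical_lebesgue"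
    and distr_orthogonal_spherical: "distr spherical_lebesgue spherical_lebesgue \<theta> = spherical_lebesgue"
proof -
  have bij: "bij \<theta>" using assms orthogonal_transformation_bij by blast
  have nrm: "norm (\<theta> x) = norm x" for x using assms orthogonal_transformation_norm by blast
  define \<eta> where "\<eta> = inv \<theta>"
  have \<eta>: "orthogonal_transformation \<eta>" unfolding \<eta>_def using assms orthogonal_transformation_inv by blast
  have *: "\<theta> -` E \<inter> sphere 0 1 \<in> spherical_sets \<and>
      emeasure lebesgue (radial_cone (\<theta> -` E \<inter> sphere 0 1)) = emeasure lebesgue (radial_cone E)"
    if E: "E \<in> spherical_sets" for E
  proof -
    have cone: "radial_cone (\<theta> -` E \<inter> sphere 0 1) = \<eta> ` radial_cone E"
    proof -
      have "\<theta> -` E \<inter> sphere 0 1 = \<eta> ` E"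
        using E bij nrm unfolding \<eta>_def spherical_sets_def bij_vimage_eq_inv_image[OF bij, symmetric] by auto
      moreover have "radial_cone (\<eta> ` E) = \<eta> ` radial_cone E"
        unfolding radial_cone_def setcompr_eq_image image_def
        using linear_scale[OF orthogonal_transformation_linear[OF \<eta>]] by force
      ultimately show ?thesis by simp
    qed
    have "radial_cone E \<subseteq> cball 0 1" using E radial_cone_sphere
      by (force simp: spherical_sets_def radial_cone_def)
    then have lm: "radial_cone E \<in> lmeasurable"
      using E unfolding spherical_sets_def
      by (intro bounded_set_imp_lmeasurable) (auto intro: bounded_subset[OF bounded_cball])
    then have lm': "\<eta> ` radial_cone E \<in> lmeasurable" 
        "measure lebesgue (\<eta> ` radial_cone E) = measure lebesgue (radial_cone E)"
      using orthogonal_image_lmeasurable[OF \<eta>] by auto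
    then show ?thesis
      using lm cone by (simp add: spherical_sets_def emeasure_eq_measure2 fmeasurableD)
  qed
  show m: "\<theta> \<in> measurable spherical_lebesgue spherical_lebesgue"
    by (rule measurableI) (use * nrm in \<open>auto simp: sets_spherical_lebesgue\<close>)
  show "distr spherical_lebesgue spherical_lebesgue \<theta> = spherical_lebesgue"
    by (rule measure_eqI)
       (use * m in \<open>auto simp: emeasure_distr sets_spherical_lebesgue emeasure_spherical_lebesgue\<close>)
qed

text \<open>Caps around a point shrink to a null set, so each point has a cap of measure below
  \<open>\<delta>\<close>; compactness leaves finitely many caps, which are then made disjoint. Such
  partitions bound charges that are controlled only on small sets, and they supply sets of roughly
  prescribed measure.\<close>

lemma sphere_small_partition:
  assumes "CARD('n) \<ge> 2" "\<delta> > 0"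
  shows "\<exists>P :: (real^'n) set set. finite P \<and> disjoint P \<and> \<Union>P = sphere 0 1 \<and>
    (\<forall>A\<in>P. A \<in> sets spherical_lebesgue \<and> measure spherical_lebesgue A < \<delta>)"
proof -
  have "\<exists>r>0. measure spherical_lebesgue (sphere 0 1 \<inter> ball x r) < \<delta>" if x: "norm x = 1" for x :: "real^'n"
  proof -
    define B where "B i = sphere 0 1 \<inter> ball x (1 / real (Suc i))" for i
    have B: "range B \<subseteq> sets spherical_lebesgue"
    proof -
      have "B i \<in> sets spherical_lebesgue" for i
        unfolding B_def by (rule sets_spherical_lebesgueI) auto
      then show ?thesis by blast
    qed
    have "decseq B"
    proof (rule decseq_SucI)
      fix i
      have "1 / real (Suc (Suc i)) \<le> 1 / real (Suc i)" by (simp add: frac_le)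
      then show "B (Suc i) \<subseteq> B i" unfolding B_def by (meson Int_mono order_refl subset_ball)
    qed
    moreover have "(\<Inter>i. B i) = {x}"
    proof -
      have "y = x" if y: "\<And>i. dist x y < 1 / real (Suc i)" for y
      proof (rule ccontr)
        assume "y \<noteq> x"
        then obtain i where "1 / real (Suc i) < dist x y"
          using nat_approx_posE[of "dist x y"] by auto
        then show False using y[of i] by simp
      qed
      then show ?thesis using x by (auto simp: B_def)
    qed
    ultimately have "(\<lambda>i. measure spherical_lebesgue (B i)) \<longlonglongrightarrow> measure spherical_lebesgue {x}"
      using spherical.finite_Lim_measure_decseq[OF B] by simp
    moreover have "measure spherical_lebesgue {x} = 0"
      using singleton_null_spherical_lebesgue[OF assms(1) x] by (simp add: measure_eq_0_null_sets)
    ultimately have "\<forall>\<^sub>F i in sequentially. measure spherical_lebesgue (B i) < \<delta>"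
      using assms(2) by (simp add: order_tendstoD(2))
    then obtain i where "measure spherical_lebesgue (B i) < \<delta>"
      by (auto simp: eventually_sequentially)
    then show ?thesis unfolding B_def by (intro exI[of _ "1 / real (Suc i)"]) auto
  qed
  then obtain r where r: "\<And>x::real^'n. norm x = 1 \<Longrightarrow> r x > 0 \<and> measure spherical_lebesgue (sphere 0 1 \<inter> ball x (r x)) < \<delta>"
    by metis
  have "compact (sphere 0 1 :: (real^'n) set)" by simp
  then obtain C where C: "C \<subseteq> sphere 0 1" "finite C" "sphere 0 1 \<subseteq> (\<Union>x\<in>C. ball x (r x))"
    by (rule compactE_image[of _ "sphere 0 1" "\<lambda>x. ball x (r x)"]) (use r in auto)
  \<comment> \<open>Listing the centres makes the caps a sequence, as \<open>disjointed\<close>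
    expects. Beyond the end of the list \<open>xs ! i\<close> is unspecified; only indices below
    \<open>length xs\<close> enter the partition.\<close>
  obtain xs where xs: "set xs = C" using finite_list[OF C(2)] by blast
  define A where "A i = sphere 0 1 \<inter> ball (xs ! i) (r (xs ! i))" for i
  define D where "D = disjointed A"
  have A: "A i \<in> sets spherical_lebesgue" for i
    unfolding A_def by (rule sets_spherical_lebesgueI) auto
  then have D: "D i \<in> sets spherical_lebesgue" for i
    unfolding D_def using sets.range_disjointed_sets[of A spherical_lebesgue] by blast
  have "measure spherical_lebesgue (D i) < \<delta>" if "i < length xs" for i
  proof -
    have "measure spherical_lebesgue (D i) \<le> measure spherical_lebesgue (A i)"
      unfolding D_def by (rule spherical.finite_measure_mono[OF disjointed_subset A])
    also have "\<dots> < \<delta>"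
    proof -
      have "xs ! i \<in> sphere 0 1" using C(1) xs that nth_mem by blast
      then show ?thesis unfolding A_def using r[of "xs ! i"] by simp
    qed
    finally show ?thesis .
  qed
  moreover have "\<Union>(D ` {..<length xs}) = sphere 0 1"
  proof -
    have "\<Union>(D ` {..<length xs}) = \<Union>(A ` {..<length xs})"
      unfolding D_def using finite_UN_disjointed_eq[of A "length xs"] by (simp add: atLeast0LessThan)
    also have "\<dots> = sphere 0 1"
    proof
      show "sphere 0 1 \<subseteq> \<Union>(A ` {..<length xs})"
      proof
        fix y :: "real^'n" assume y: "y \<in> sphere 0 1"
        then obtain x where "x \<in> set xs" "y \<in> ball x (r x)" using C xs by blast
        then obtain i where "i < length xs" "y \<in> ball (xs ! i) (r (xs ! i))" by (metis in_set_conv_nth)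
        then show "y \<in> \<Union>(A ` {..<length xs})" using y by (auto simp: A_def)
      qed
    qed (auto simp: A_def)
    finally show ?thesis .
  qed
  moreover have "disjoint (D ` {..<length xs})"
    unfolding D_def using disjoint_family_disjointed[of A]
    by (simp add: disjoint_family_on_disjoint_image disjoint_family_on_mono[OF subset_UNIV])
  ultimately show ?thesis
    using D by (intro exI[of _ "D ` {..<length xs}"]) auto
qed

section \<open>Uniqueness of rotation invariant charges\<close>

text \<open>The map is the reflection in the hyperplane orthogonal to \<open>v\<close>. For
  \<open>v = 0\<close> the quotient is 0 and the map is the identity, which is orthogonal as
  well.\<close>

lemma orthogonal_transformation_reflect:
  fixes v :: "'a::real_inner"
  shows "orthogonal_transformation (\<lambda>x. x - (2 * (v \<bullet> x) / (v \<bullet> v)) *\<^sub>R v)"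
  unfolding orthogonal_transformation_def
proof (intro conjI allI)
  show "linear (\<lambda>x. x - (2 * (v \<bullet> x) / (v \<bullet> v)) *\<^sub>R v)"
    by (rule linearI) (auto simp: inner_add_right algebra_simps add_divide_distrib)
  show "(x - (2 * (v \<bullet> x) / (v \<bullet> v)) *\<^sub>R v) \<bullet> (y - (2 * (v \<bullet> y) / (v \<bullet> v)) *\<^sub>R v) = x \<bullet> y" for x y
    by (cases "v = 0") (auto simp: inner_diff_left inner_diff_right inner_commute)
qed

text \<open>Measurability on the sphere is defined through cones, so radial projection from the
  punctured ball is measurable almost by definition. Cones are only Lebesgue sets, hence
  \<open>lebesgue\<close> in the conclusion.\<close>

lemma borel_measurable_radial_extension:
  fixes \<phi> :: "real^'n \<Rightarrow> real"
  assumes [measurable]: "\<phi> \<in> borel_measurable spherical_lebesgue"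
  shows "(\<lambda>x. if x \<noteq> 0 \<and> norm x \<le> 1 then \<phi> (x /\<^sub>R norm x) else 0) \<in> borel_measurable lebesgue"
proof -
  let ?B = "{x::real^'n. x \<noteq> 0 \<and> norm x \<le> 1}"
  have B: "?B \<in> sets lebesgue"
  proof -
    have "?B = cball 0 1 - {0}" by auto
    then show ?thesis by simp
  qed
  have "(\<lambda>x. x /\<^sub>R norm x) \<in> measurable (restrict_space lebesgue ?B) spherical_lebesgue"
  proof (rule measurableI)
    fix E :: "(real^'n) set" assume "E \<in> sets spherical_lebesgue"
    then have E: "E \<subseteq> sphere 0 1" "radial_cone E \<in> sets lebesgue"
      by (auto simp: sets_spherical_lebesgue spherical_sets_def)
    have "(\<lambda>x. x /\<^sub>R norm x) -` E \<inter> space (restrict_space lebesgue ?B) = radial_cone E - {0}"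
      unfolding radial_cone_minus_zero[OF E(1)] by (auto simp: space_restrict_space)
    moreover have "radial_cone E - {0} \<in> sets (restrict_space lebesgue ?B)"
    proof -
      have "radial_cone E - {0} \<in> sets lebesgue" using E(2) by (simp only: lebesgue_insert_zero_iff)
      moreover have "radial_cone E - {0} \<subseteq> ?B" by (auto simp: radial_cone_minus_zero[OF E(1)])
      ultimately show ?thesis using B by (simp add: sets_restrict_space_iff)
    qed
    ultimately show "(\<lambda>x. x /\<^sub>R norm x) -` E \<inter> space (restrict_space lebesgue ?B)
        \<in> sets (restrict_space lebesgue ?B)" by simp
  qed (auto simp: space_restrict_space)
  then have "(\<lambda>x. \<phi> (x /\<^sub>R norm x)) \<in> borel_measurable (restrict_space lebesgue ?B)"
    by (rule measurable_compose) fact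
  then show ?thesis
    using B by (subst measurable_If_restrict_space_iff) auto
qed

text \<open>The variable is the reflecting vector, while the reflected point \<open>x\<close> stays
  fixed. Differentiability lets the map send negligible sets of vectors to negligible sets of image
  points.\<close>

lemma differentiable_norm_reflect:
  fixes x v :: "'a::euclidean_space"
  assumes "v \<noteq> 0"
  shows "(\<lambda>v. norm v *\<^sub>R (x - (2 * (v \<bullet> x) / (v \<bullet> v)) *\<^sub>R v)) differentiable (at v)"
proof -
  have 1: "(\<lambda>v::'a. norm v) differentiable (at v)"
    using assms differentiable_norm_at by blast
  have 2: "(\<lambda>v. v \<bullet> x) differentiable (at v)" "(\<lambda>v::'a. v \<bullet> v) differentiable (at v)"
    unfolding differentiable_def by (auto intro!: exI derivative_eq_intros)
  have 3: "v \<bullet> v \<noteq> 0" using assms by simp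
  show ?thesis
    using 1 2 3 by (intro differentiable_scaleR differentiable_diff differentiable_const differentiable_divide differentiable_mult differentiable_ident)
qed

text \<open>For equal norms, \<open>(x - y) \<bullet> (x - y) = 2 * ((x - y) \<bullet> x)\<close>,
  so reflecting along \<open>x - y\<close> carries \<open>x\<close> to \<open>y\<close>. The
  reflection depends only on the line of \<open>v\<close>; the factor \<open>t\<close> leaves the
  norm of \<open>v\<close> free to be prescribed.\<close>

lemma reflect_surj:
  fixes x y :: "'a::euclidean_space"
  assumes "norm x = norm y" "x \<noteq> y" and "v = t *\<^sub>R (x - y)" "t \<noteq> 0"
  shows "x - (2 * (v \<bullet> x) / (v \<bullet> v)) *\<^sub>R v = y"
proof -
  have "x \<bullet> x = y \<bullet> y" using assms(1) by (simp add: dot_square_norm)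
  then have "(x - y) \<bullet> (x - y) = 2 * ((x - y) \<bullet> x)"
    by (simp add: inner_diff_left inner_diff_right inner_commute)
  moreover have "(x - y) \<bullet> (x - y) \<noteq> 0" using assms(2) by simp
  ultimately have "2 * ((x - y) \<bullet> x) / ((x - y) \<bullet> (x - y)) = 1"
    by simp
  moreover have "2 * (v \<bullet> x) / (v \<bullet> v) = (2 * ((x - y) \<bullet> x) / ((x - y) \<bullet> (x - y))) / t"
    using assms(4) unfolding assms(3) by simp
  ultimately have "2 * (v \<bullet> x) / (v \<bullet> v) = 1 / t" by (simp only:)
  then show ?thesis using assms(3,4) by simp
qed

text \<open>Off the line through \<open>x\<close>, every nonzero \<open>y\<close> with
  \<open>norm y \<le> norm x\<close> is reached from \<open>x\<close> by some vector
  \<open>v\<close> in the punctured unit ball. The bad points therefore lie in the image of the bad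
  vectors together with that line, both negligible.\<close>

lemma negligible_norm_reflect_image:
  fixes x :: "real^'n"
  assumes "CARD('n) \<ge> 2" "x \<noteq> 0" and N: "negligible {v. v \<noteq> 0 \<and> norm v \<le> 1 \<and>
     \<not> P (norm v *\<^sub>R (x - (2 * (v \<bullet> x) / (v \<bullet> v)) *\<^sub>R v))}" (is "negligible ?N")
  shows "negligible {y. y \<noteq> 0 \<and> norm y \<le> norm x \<and> \<not> P y}"
proof -
  let ?g = "\<lambda>v. norm v *\<^sub>R (x - (2 * (v \<bullet> x) / (v \<bullet> v)) *\<^sub>R v)"
  have "?g differentiable_on ?N"
    unfolding differentiable_on_def
    using differentiable_norm_reflect differentiable_at_withinI by blast
  then have "negligible (?g ` ?N)"
    using N by (intro negligible_differentiable_image_negligible) auto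
  moreover have "negligible (span {x})"
    by (rule negligible_lowdim) (use assms(1) dim_le_card'[of "{x}"] in simp)
  ultimately have "negligible (?g ` ?N \<union> span {x})" by (rule negligible_Un)
  moreover have "{y. y \<noteq> 0 \<and> norm y \<le> norm x \<and> \<not> P y} \<subseteq> ?g ` ?N \<union> span {x}"
  proof (intro subsetI, rule ccontr)
    fix y assume y: "y \<in> {y. y \<noteq> 0 \<and> norm y \<le> norm x \<and> \<not> P y}" and n: "y \<notin> ?g ` ?N \<union> span {x}"
    \<comment> \<open>Writing \<open>y\<close> as \<open>s *\<^sub>R z\<close> with
      \<open>norm z = norm x\<close> separates the two effects of \<open>v\<close>: its direction
      must reflect \<open>x\<close> to \<open>z\<close>, and its norm must be
      \<open>s\<close>.\<close>
    define s where "s = norm y / norm x"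
    define z where "z = (1 / s) *\<^sub>R y"
    have s: "s > 0" "s \<le> 1" using y assms(2) by (auto simp: s_def)
    have z: "norm z = norm x" using y s by (simp add: z_def s_def)
    have "x \<noteq> z"
    proof
      assume "x = z"
      then have "y = s *\<^sub>R x" using s by (simp add: z_def)
      then show False using n by (simp add: span_base span_scale)
    qed
    define v where "v = (s / norm (x - z)) *\<^sub>R (x - z)"
    have nv: "norm v = s" using s \<open>x \<noteq> z\<close> by (simp add: v_def)
    have "x - (2 * (v \<bullet> x) / (v \<bullet> v)) *\<^sub>R v = z"
      by (rule reflect_surj[where t = "s / norm (x - z)"]) (use z s \<open>x \<noteq> z\<close> in \<open>auto simp: v_def\<close>)
    then have "?g v = y" using nv s by (simp add: z_def)
    then have "v \<in> ?N" using y nv s by auto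
    then show False using n \<open>?g v = y\<close> by (metis (no_types, lifting) UnI1 image_eqI)
  qed
  ultimately show ?thesis by (rule negligible_subset)
qed

text \<open>Reflections are parametrised by vectors: \<open>v\<close> acts on the ball by the reflection along
  \<open>v\<close> followed by multiplication with \<open>norm v\<close>. By Fubini, there is a single \<open>x\<close> such that the
  radial extension of \<open>\<phi>\<close> has the value at \<open>x\<close> also at the image of \<open>x\<close> under almost every \<open>v\<close>,
  and these images cover almost all of a ball.\<close>

lemma rotation_invariant_AE_const:
  fixes \<phi> :: "real^'n \<Rightarrow> real"
  assumes n: "CARD('n) \<ge> 2" and \<phi>: "\<phi> \<in> borel_measurable spherical_lebesgue"
    and inv: "\<And>\<theta>. orthogonal_transformation \<theta> \<Longrightarrow> AE u in spherical_lebesgue. \<phi> (\<theta> u) = \<phi> u"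
  shows "\<exists>c. AE u in spherical_lebesgue. \<phi> u = c"
proof -
  define B where "B x \<longleftrightarrow> x \<noteq> 0 \<and> norm x \<le> 1" for x :: "real^'n"
  define \<phi>' where "\<phi>' x = (if B x then \<phi> (x /\<^sub>R norm x) else 0)" for x
  have "\<phi>' \<in> borel_measurable lebesgue"
    unfolding \<phi>'_def B_def by (rule borel_measurable_radial_extension[OF \<phi>])
  \<comment> \<open>The extension is only Lebesgue measurable; a Borel version is needed so that the
    set of pairs \<open>(v, x)\<close> below is measurable for the product of two copies of
    \<open>lborel\<close>.\<close>
  then obtain \<psi> where [measurable]: "\<psi> \<in> borel_measurable lborel" and ae: "AE x in lborel. \<phi>' x = \<psi> x"
    using completion_ex_borel_measurable_real by blast
  define N where "N = {x. \<phi>' x \<noteq> \<psi> x}"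
  have N: "negligible N" using ae by (simp add: N_def AE_lborel_iff_negligible)
  define R where "R v x = x - (2 * (v \<bullet> x) / (v \<bullet> v)) *\<^sub>R v" for v x :: "real^'n"
  have R: "orthogonal_transformation (R v)" for v
    unfolding R_def by (rule orthogonal_transformation_reflect)
  have R_norm: "norm (R v x) = norm x" for v x
    using R orthogonal_transformation_norm by blast
  have R_scale: "R v (a *\<^sub>R x) = a *\<^sub>R R v x" for v x a
    using R orthogonal_transformation_linear linear_scale by blast
  have R_R: "R v (R v x) = x" for v x
    by (cases "v = 0") (auto simp: R_def inner_diff_right)
  have "AE x in lborel. B v \<longrightarrow> B x \<longrightarrow> \<psi> (norm v *\<^sub>R R v x) = \<psi> x" for v
  proof (cases "B v")
    case True
    then have v: "v \<noteq> 0" "norm v \<le> 1" by (auto simp: B_def)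
    \<comment> \<open>This map inverts \<open>x \<mapsto> norm v *\<^sub>R R v x\<close>, since
      reflections are involutions. For \<open>x\<close> outside the image of \<open>N\<close>, the
      moved point avoids \<open>N\<close>, where the two versions of the function differ.\<close>
    have "linear (\<lambda>x. (1 / norm v) *\<^sub>R R v x)"
      using R orthogonal_transformation_linear linear_compose_scale_right by blast
    then have "negligible ((\<lambda>x. (1 / norm v) *\<^sub>R R v x) ` N)"
      using N by (intro negligible_differentiable_image_negligible linear_imp_differentiable_on) auto
    moreover have "negligible {x. x \<noteq> 0 \<and> norm x \<le> 1 \<and> \<not> \<phi> (R v (x /\<^sub>R norm x)) = \<phi> (x /\<^sub>R norm x)}"
      using inv[OF R, of v] unfolding AE_spherical_lebesgue_iff .
    ultimately have "negligible ((\<lambda>x. (1 / norm v) *\<^sub>R R v x) ` N \<union> N \<union>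
        {x. x \<noteq> 0 \<and> norm x \<le> 1 \<and> \<not> \<phi> (R v (x /\<^sub>R norm x)) = \<phi> (x /\<^sub>R norm x)})"
      using N by (intro negligible_Un)
    moreover have "{x. \<not> (B v \<longrightarrow> B x \<longrightarrow> \<psi> (norm v *\<^sub>R R v x) = \<psi> x)} \<subseteq> \<dots>"
    proof (intro subsetI, rule ccontr)
      fix x assume x: "x \<in> {x. \<not> (B v \<longrightarrow> B x \<longrightarrow> \<psi> (norm v *\<^sub>R R v x) = \<psi> x)}"
        and n: "x \<notin> (\<lambda>x. (1 / norm v) *\<^sub>R R v x) ` N \<union> N \<union>
        {x. x \<noteq> 0 \<and> norm x \<le> 1 \<and> \<not> \<phi> (R v (x /\<^sub>R norm x)) = \<phi> (x /\<^sub>R norm x)}"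
      have Bx: "B x" and x0: "x \<noteq> 0" "norm x \<le> 1" using x by (auto simp: B_def)
      have "norm v *\<^sub>R R v x \<notin> N"
      proof
        assume "norm v *\<^sub>R R v x \<in> N"
        moreover have "x = (1 / norm v) *\<^sub>R R v (norm v *\<^sub>R R v x)"
          using v by (simp add: R_scale R_R)
        ultimately show False using n by blast
      qed
      then have "\<psi> (norm v *\<^sub>R R v x) = \<phi>' (norm v *\<^sub>R R v x)" by (simp add: N_def)
      also have "\<dots> = \<phi> (R v (x /\<^sub>R norm x))"
      proof -
        have "norm (norm v *\<^sub>R R v x) = norm v * norm x" by (simp add: R_norm)
        moreover have "norm v * norm x \<le> 1" using v x0 mult_le_one by fastforce
        moreover have "norm v * norm x \<noteq> 0" using v x0 by simp
        ultimately have "B (norm v *\<^sub>R R v x)" unfolding B_def by (metis norm_zero)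
        moreover have "(norm v *\<^sub>R R v x) /\<^sub>R norm (norm v *\<^sub>R R v x) = R v (x /\<^sub>R norm x)"
          using v by (simp add: R_norm R_scale)
        ultimately show ?thesis by (simp add: \<phi>'_def)
      qed
      also have "\<dots> = \<phi> (x /\<^sub>R norm x)" using n x0 by blast
      also have "\<dots> = \<phi>' x" using Bx by (simp add: \<phi>'_def)
      also have "\<dots> = \<psi> x" using n by (auto simp: N_def)
      finally show False using x by simp
    qed
    ultimately show ?thesis
      unfolding AE_lborel_iff_negligible by (rule negligible_subset)
  qed simp
  then have "AE v in lborel. AE x in lborel. B v \<longrightarrow> B x \<longrightarrow> \<psi> (norm v *\<^sub>R R v x) = \<psi> x" by simp
  moreover have "{z \<in> space (lborel \<Otimes>\<^sub>M lborel). B (fst z) \<longrightarrow> B (snd z) \<longrightarrow>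
      \<psi> (norm (fst z) *\<^sub>R R (fst z) (snd z)) = \<psi> (snd z)} \<in> sets (lborel \<Otimes>\<^sub>M lborel)"
    unfolding B_def R_def by measurable
  ultimately have "AE x in lborel. AE v in lborel. B v \<longrightarrow> B x \<longrightarrow> \<psi> (norm v *\<^sub>R R v x) = \<psi> x"
    using lborel_pair.AE_commute[of "\<lambda>v x. B v \<longrightarrow> B x \<longrightarrow> \<psi> (norm v *\<^sub>R R v x) = \<psi> x"] by blast
  moreover have "\<not> (AE x in lborel. \<not> B x)"
  proof
    assume "AE x in lborel. \<not> B x"
    then have "negligible {x. B x}" by (simp add: AE_lborel_iff_negligible)
    then have "negligible (insert 0 {x. B x})" by (simp only: negligible_insert)
    then have "negligible (ball 0 1 :: (real^'n) set)"
      by (rule negligible_subset) (auto simp: B_def)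
    then show False using open_not_negligible[of "ball 0 1 :: (real^'n) set"] by simp
  qed
  ultimately obtain x where x: "B x" "AE v in lborel. B v \<longrightarrow> \<psi> (norm v *\<^sub>R R v x) = \<psi> x"
    by (elim contrapos_np[of "AE x in lborel. \<not> B x"] eventually_mono) auto
  have x0: "x \<noteq> 0" using x by (simp add: B_def)
  have "negligible {v. v \<noteq> 0 \<and> norm v \<le> 1 \<and> \<psi> (norm v *\<^sub>R R v x) \<noteq> \<psi> x}"
    using x(2) by (simp add: AE_lborel_iff_negligible B_def)
  then have "negligible {y. y \<noteq> 0 \<and> norm y \<le> norm x \<and> \<psi> y \<noteq> \<psi> x}"
    unfolding R_def by (rule negligible_norm_reflect_image[OF n x0])
  \<comment> \<open>So far the bad set is controlled only in the ball of radius
    \<open>norm x\<close>. As \<open>\<phi>\<close> is evaluated at directions, scaling by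
    \<open>1 / norm x\<close> carries the conclusion to the whole unit ball; \<open>N\<close> is
    included to return from \<open>\<psi>\<close> to \<open>\<phi>'\<close>.\<close>
  then have "negligible ((\<lambda>y. (1 / norm x) *\<^sub>R y) ` ({y. y \<noteq> 0 \<and> norm y \<le> norm x \<and> \<psi> y \<noteq> \<psi> x} \<union> N))"
    using N by (intro negligible_differentiable_image_negligible negligible_Un linear_imp_differentiable_on) auto
  moreover have "{y. y \<noteq> 0 \<and> norm y \<le> 1 \<and> \<phi> (y /\<^sub>R norm y) \<noteq> \<psi> x} \<subseteq> \<dots>"
  proof
    fix y assume y: "y \<in> {y. y \<noteq> 0 \<and> norm y \<le> 1 \<and> \<phi> (y /\<^sub>R norm y) \<noteq> \<psi> x}"
    define z where "z = norm x *\<^sub>R y"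
    have z0: "z \<noteq> 0" "norm z \<le> norm x" using y x0 by (auto simp: z_def mult_left_le)
    have "norm x \<le> 1" using x(1) by (simp add: B_def)
    moreover have "z /\<^sub>R norm z = y /\<^sub>R norm y" using x0 by (simp add: z_def field_simps)
    ultimately have "\<phi>' z = \<phi> (y /\<^sub>R norm y)"
      using z0 by (simp add: \<phi>'_def B_def)
    then have "z \<in> {y. y \<noteq> 0 \<and> norm y \<le> norm x \<and> \<psi> y \<noteq> \<psi> x} \<union> N"
      using y z0 by (auto simp: N_def)
    moreover have "y = (1 / norm x) *\<^sub>R z" using x0 by (simp add: z_def)
    ultimately show "y \<in> (\<lambda>y. (1 / norm x) *\<^sub>R y) ` ({y. y \<noteq> 0 \<and> norm y \<le> norm x \<and> \<psi> y \<noteq> \<psi> x} \<union> N)"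
      by blast
  qed
  ultimately have "negligible {y. y \<noteq> 0 \<and> norm y \<le> 1 \<and> \<phi> (y /\<^sub>R norm y) \<noteq> \<psi> x}"
    by (rule negligible_subset)
  then have "AE u in spherical_lebesgue. \<phi> u = \<psi> x" by (simp add: AE_spherical_lebesgue_iff)
  then show ?thesis by blast
qed

text \<open>If \<open>D\<close> is a Radon-Nikodym density of \<open>N\<close>, invariance of both
  measures makes \<open>D\<close> composed with a rotation a density of \<open>N\<close> too.
  Uniqueness of densities gives equality almost everywhere for each rotation, which forces
  \<open>D\<close> to be almost everywhere constant.\<close>

lemma rotation_invariant_measure_proportional:
  fixes N :: "(real^'n) measure"
  assumes n: "CARD('n) \<ge> 2" and "finite_measure N" and sets_N: "sets N = sets spherical_lebesgue"
    and ac: "absolutely_continuous spherical_lebesgue N"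
    and inv: "\<And>\<theta> E. orthogonal_transformation \<theta> \<Longrightarrow> E \<in> sets spherical_lebesgue \<Longrightarrow>
      emeasure N (\<theta> -` E \<inter> sphere 0 1) = emeasure N E"
  shows "\<exists>c. \<forall>E\<in>sets spherical_lebesgue. measure N E = c * measure spherical_lebesgue E"
proof -
  let ?S = "spherical_lebesgue :: (real^'n) measure"
  obtain D where [measurable]: "D \<in> borel_measurable ?S"
    and D: "AE u in ?S. RN_deriv ?S N u = ennreal (D u)" and D_nonneg: "\<And>u. 0 \<le> D u"
    using spherical.real_RN_deriv[OF \<open>finite_measure N\<close> ac sets_N] by metis
  have N: "N = density ?S (\<lambda>u. ennreal (D u))"
  proof -
    have "N = density ?S (RN_deriv ?S N)"
      using spherical.density_RN_deriv[OF ac sets_N] by simp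
    also have "\<dots> = density ?S (\<lambda>u. ennreal (D u))"
      using D by (intro density_cong) auto
    finally show ?thesis .
  qed
  have "AE u in ?S. D (\<theta> u) = D u" if \<theta>: "orthogonal_transformation \<theta>" for \<theta>
  proof -
    define \<eta> where "\<eta> = inv \<theta>"
    have \<eta>: "orthogonal_transformation \<eta>" unfolding \<eta>_def using \<theta> orthogonal_transformation_inv by blast
    have \<eta>\<theta>: "\<eta> (\<theta> u) = u" for u
      unfolding \<eta>_def using \<theta> by (simp add: orthogonal_transformation_inj)
    note [measurable] = measurable_orthogonal_spherical[OF \<theta>] measurable_orthogonal_spherical[OF \<eta>]
    have "density ?S (\<lambda>u. ennreal (D (\<theta> u))) = density ?S (\<lambda>u. ennreal (D u))"
    proof (rule measure_eqI)
      fix E assume "E \<in> sets (density ?S (\<lambda>u. ennreal (D (\<theta> u))))"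
      then have E[measurable]: "E \<in> sets ?S" by simp
      have \<eta>E[measurable]: "\<eta> -` E \<inter> sphere 0 1 \<in> sets ?S"
        using measurable_sets[OF measurable_orthogonal_spherical[OF \<eta>] E] by simp
      have "emeasure (density ?S (\<lambda>u. ennreal (D (\<theta> u)))) E
          = (\<integral>\<^sup>+u. ennreal (D (\<theta> u)) * indicator E u \<partial>?S)"
        by (simp add: emeasure_density)
      \<comment> \<open>Inserting the inverse \<open>\<eta>\<close> makes the whole integrand a
        function of \<open>\<theta> u\<close>, ready for the change of variables.\<close>
      also have "\<dots> = (\<integral>\<^sup>+u. ennreal (D (\<theta> u)) * indicator (\<eta> -` E \<inter> sphere 0 1) (\<theta> u) \<partial>?S)"
        by (intro nn_integral_cong)
           (auto simp: indicator_def \<eta>\<theta> orthogonal_transformation_norm[OF \<theta>])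
      also have "\<dots> = (\<integral>\<^sup>+u. ennreal (D u) * indicator (\<eta> -` E \<inter> sphere 0 1) u \<partial>distr ?S ?S \<theta>)"
        by (simp add: nn_integral_distr)
      also have "\<dots> = emeasure N (\<eta> -` E \<inter> sphere 0 1)"
        by (subst distr_orthogonal_spherical[OF \<theta>]) (simp add: N emeasure_density)
      also have "\<dots> = emeasure (density ?S (\<lambda>u. ennreal (D u))) E"
        unfolding inv[OF \<eta> E] by (simp add: N)
      finally show "emeasure (density ?S (\<lambda>u. ennreal (D (\<theta> u)))) E
          = emeasure (density ?S (\<lambda>u. ennreal (D u))) E" .
    qed simp
    then have "AE u in ?S. ennreal (D (\<theta> u)) = ennreal (D u)"
      by (intro spherical.density_unique) auto
    then show ?thesis using D_nonneg by simp
  qed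
  then obtain c where c: "AE u in ?S. D u = c"
    using rotation_invariant_AE_const[OF n, of D] by auto
  \<comment> \<open>Truncation at 0 replaces a separate argument that \<open>c\<close> is
    nonnegative: wherever \<open>D u = c\<close>, nonnegativity of \<open>D\<close> gives
    \<open>max 0 c = D u\<close>.\<close>
  have "measure N E = max 0 c * measure ?S E" if [measurable]: "E \<in> sets ?S" for E
  proof -
    have "emeasure N E = (\<integral>\<^sup>+u. ennreal (D u) * indicator E u \<partial>?S)"
      by (simp add: N emeasure_density)
    also have "\<dots> = (\<integral>\<^sup>+u. ennreal (max 0 c) * indicator E u \<partial>?S)"
      using c D_nonneg by (intro nn_integral_cong_AE) (auto elim!: eventually_mono simp: max_def)
    also have "\<dots> = ennreal (max 0 c) * emeasure ?S E"
      by (simp add: nn_integral_cmult_indicator)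
    finally show ?thesis
      by (simp add: measure_def enn2real_mult)
  qed
  then show ?thesis by blast
qed

text \<open>Boundedness is derived from absolute continuity: on a finite partition into pieces so
  small that the charge of any subset is below 1 in absolute value, the total is at most the number
  of pieces. The Jordan parts are then invariant measures, and evaluation on the whole sphere
  identifies the constant.\<close>

lemma rotation_invariant_charge_proportional:
  fixes \<nu> :: "(real^'n) set \<Rightarrow> real"
  assumes n: "CARD('n) \<ge> 2"
    and additive: "\<And>A B. A \<in> sets spherical_lebesgue \<Longrightarrow> B \<in> sets spherical_lebesgue \<Longrightarrow>
      A \<inter> B = {} \<Longrightarrow> \<nu> (A \<union> B) = \<nu> A + \<nu> B"
    and abs_cont: "\<And>e. e > 0 \<Longrightarrow> \<exists>d>0. \<forall>A\<in>sets spherical_lebesgue.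
      measure spherical_lebesgue A < d \<longrightarrow> \<bar>\<nu> A\<bar> < e"
    and inv: "\<And>\<theta> E. orthogonal_transformation \<theta> \<Longrightarrow> E \<in> sets spherical_lebesgue \<Longrightarrow>
      \<nu> (\<theta> -` E \<inter> sphere 0 1) = \<nu> E"
    and E: "E \<in> sets spherical_lebesgue"
  shows "\<nu> E = \<nu> (sphere 0 1) / measure spherical_lebesgue (sphere 0 1 :: (real^'n) set)
    * measure spherical_lebesgue E"
proof -
  let ?S = "spherical_lebesgue :: (real^'n) measure"
  have empty: "\<nu> {} = 0" using additive[of "{}" "{}"] by simp
  obtain d where d: "d > 0" "\<And>A. A \<in> sets ?S \<Longrightarrow> measure ?S A < d \<Longrightarrow> \<bar>\<nu> A\<bar> < 1"
    using abs_cont[of 1] by auto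
  obtain P where P: "finite P" "disjoint P" "\<Union>P = (sphere 0 1 :: (real^'n) set)"
    "\<And>A. A \<in> P \<Longrightarrow> A \<in> sets ?S \<and> measure ?S A < d"
    using sphere_small_partition[OF n d(1)] by blast
  have bounded: "\<bar>\<nu> A\<bar> \<le> real (card P)" if A: "A \<in> sets ?S" for A
  proof -
    have "\<bar>\<nu> (A \<inter> \<Union>Q)\<bar> \<le> real (card Q)" if "Q \<subseteq> P" for Q
      using finite_subset[OF that P(1)] that
    proof (induction Q)
      case empty
      then show ?case using \<open>\<nu> {} = 0\<close> by simp
    next
      case (insert B Q)
      have B: "B \<in> sets ?S" "measure ?S B < d" using insert.prems P(4) by auto
      have Q: "\<Union>Q \<in> sets ?S" using insert P(4) by (intro sets.finite_Union) auto
      have "B \<inter> X = {}" if "X \<in> Q" for X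
        using insert.prems insert.hyps(2) that by (intro disjointD[OF P(2)]) auto
      then have "B \<inter> \<Union>Q = {}" by blast
      then have "\<nu> ((A \<inter> B) \<union> (A \<inter> \<Union>Q)) = \<nu> (A \<inter> B) + \<nu> (A \<inter> \<Union>Q)"
        using A B(1) Q by (intro additive) auto
      moreover have "\<bar>\<nu> (A \<inter> B)\<bar> < 1"
      proof (rule d(2))
        show "measure ?S (A \<inter> B) < d"
          using spherical.finite_measure_mono[of "A \<inter> B" B] B by simp
      qed (use A B in auto)
      moreover have "\<bar>\<nu> (A \<inter> \<Union>Q)\<bar> \<le> real (card Q)" using insert by simp
      moreover have "A \<inter> \<Union>(insert B Q) = (A \<inter> B) \<union> (A \<inter> \<Union>Q)" by auto
      ultimately show ?case using insert.hyps by simp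
    qed
    from this[of P] show ?thesis
      using A sets.sets_into_space[of A ?S] P(3) by (simp add: Int_absorb2)
  qed
  have proportional: "\<exists>c. \<forall>E\<in>sets ?S. upper_variation ?S \<mu> E = c * measure ?S E"
    if "abs_continuous_charge ?S \<mu>" and
      rot: "\<And>\<theta> E. orthogonal_transformation \<theta> \<Longrightarrow> E \<in> sets ?S \<Longrightarrow> \<mu> (\<theta> -` E \<inter> sphere 0 1) = \<mu> E" for \<mu>
  proof -
    interpret \<mu>: abs_continuous_charge ?S \<mu> by fact
    obtain N where N: "sets N = sets ?S" "finite_measure N" "absolutely_continuous ?S N"
      "\<And>A. A \<in> sets ?S \<Longrightarrow> emeasure N A = ennreal (upper_variation ?S \<mu> A)"
      using \<mu>.upper_variation_measure by metis
    \<comment> \<open>Pulling back competitors in the supremum gives one inequality for every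
      rotation; applying it to the inverse rotation gives the other.\<close>
    have le: "upper_variation ?S \<mu> E \<le> upper_variation ?S \<mu> (\<theta> -` E \<inter> sphere 0 1)"
      if \<theta>: "orthogonal_transformation \<theta>" and E: "E \<in> sets ?S" for \<theta> E
    proof (rule \<mu>.upper_variation_le)
      fix F assume F: "F \<in> sets ?S" "F \<subseteq> E"
      have "\<mu> F = \<mu> (\<theta> -` F \<inter> sphere 0 1)" using rot[OF \<theta> F(1)] by simp
      also have "\<dots> \<le> upper_variation ?S \<mu> (\<theta> -` E \<inter> sphere 0 1)"
        using F measurable_sets[OF measurable_orthogonal_spherical[OF \<theta>], of F]
        by (intro \<mu>.upper_variation_ge) auto
      finally show "\<mu> F \<le> upper_variation ?S \<mu> (\<theta> -` E \<inter> sphere 0 1)" .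
    qed
    have "upper_variation ?S \<mu> (\<theta> -` E \<inter> sphere 0 1) = upper_variation ?S \<mu> E"
      if \<theta>: "orthogonal_transformation \<theta>" and E: "E \<in> sets ?S" for \<theta> E
    proof (rule antisym[OF _ le[OF \<theta> E]])
      define \<eta> where "\<eta> = inv \<theta>"
      have \<eta>: "orthogonal_transformation \<eta>" unfolding \<eta>_def using \<theta> orthogonal_transformation_inv by blast
      have "\<theta> (\<eta> u) = u" for u
        unfolding \<eta>_def using \<theta> by (meson orthogonal_transformation_surj surj_f_inv_f)
      moreover have "\<theta> -` E \<inter> sphere 0 1 \<in> sets ?S"
        using measurable_sets[OF measurable_orthogonal_spherical[OF \<theta>] E] by simp
      moreover have "E \<subseteq> sphere 0 1" using sets.sets_into_space[OF E] by simp
      ultimately have "\<eta> -` (\<theta> -` E \<inter> sphere 0 1) \<inter> sphere 0 1 = E"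
          and "\<theta> -` E \<inter> sphere 0 1 \<in> sets ?S"
        by (auto simp: orthogonal_transformation_norm[OF \<eta>])
      then show "upper_variation ?S \<mu> (\<theta> -` E \<inter> sphere 0 1) \<le> upper_variation ?S \<mu> E"
        using le[OF \<eta>, of "\<theta> -` E \<inter> sphere 0 1"] by simp
    qed
    then have "emeasure N (\<theta> -` E \<inter> sphere 0 1) = emeasure N E"
      if "orthogonal_transformation \<theta>" and "E \<in> sets ?S" for \<theta> E
      using that N(4)[of E] N(4)[of "\<theta> -` E \<inter> sphere 0 1"]
        measurable_sets[OF measurable_orthogonal_spherical, of \<theta> E] by simp
    then obtain c where "\<forall>E\<in>sets ?S. measure N E = c * measure ?S E"
      using rotation_invariant_measure_proportional[OF n N(2,1,3)] by blast
    moreover have "measure N E = upper_variation ?S \<mu> E" if "E \<in> sets ?S" for E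
      using N(4)[OF that] \<mu>.upper_variation_nonneg by (simp add: measure_def)
    ultimately show ?thesis by auto
  qed
  interpret \<nu>: abs_continuous_charge ?S \<nu>
  proof
    show "\<exists>C. \<forall>A\<in>sets ?S. \<bar>\<nu> A\<bar> \<le> C" using bounded by blast
  qed (fact additive abs_cont)+
  have neg: "abs_continuous_charge ?S (\<lambda>E. - \<nu> E)"
    by (rule \<nu>.uminus)
  obtain c1 where c1: "\<forall>E\<in>sets ?S. upper_variation ?S \<nu> E = c1 * measure ?S E"
    using proportional[OF \<nu>.abs_continuous_charge_axioms inv] by blast
  obtain c2 where c2: "\<forall>E\<in>sets ?S. upper_variation ?S (\<lambda>E. - \<nu> E) E = c2 * measure ?S E"
    using proportional[OF neg] inv by auto
  have *: "\<nu> E = (c1 - c2) * measure ?S E" if "E \<in> sets ?S" for E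
    using \<nu>.upper_variation_diff[OF that] c1 c2 that by (simp add: algebra_simps)
  have "sphere 0 1 \<in> sets ?S" using sets.top[of ?S] by simp
  then have "\<nu> (sphere 0 1) / measure ?S (sphere 0 1) = c1 - c2"
    using measure_sphere_pos[where 'n='n] * by simp
  then show ?thesis using *[OF E] by simp
qed

section \<open>Real valuations\<close>

text \<open>The functional acts on functions, not on classes; that it respects equality almost
  everywhere is extracted from \<open>continuous\<close> in \<open>cong_AE\<close>. Convergence is
  expressed by integrals of p-th powers, avoiding the root in the norm.\<close>

locale rotation_invariant_valuation =
  fixes p :: real and \<Psi> :: "(real^'n \<Rightarrow> real) \<Rightarrow> real"
  assumes n: "CARD('n) \<ge> 2" and p: "p \<ge> 1"
    and valuation: "f \<in> Lp_space spherical_lebesgue p \<Longrightarrow> g \<in> Lp_space spherical_lebesgue p \<Longrightarrow>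
      \<Psi> (\<lambda>u. max (f u) (g u)) + \<Psi> (\<lambda>u. min (f u) (g u)) = \<Psi> f + \<Psi> g"
    and zero: "\<Psi> (\<lambda>u. 0) = 0"
    and continuous: "(\<And>i. F i \<in> Lp_space spherical_lebesgue p) \<Longrightarrow> f \<in> Lp_space spherical_lebesgue p \<Longrightarrow>
      (\<lambda>i. \<integral>u. \<bar>F i u - f u\<bar> powr p \<partial>spherical_lebesgue) \<longlonglongrightarrow> 0 \<Longrightarrow> (\<lambda>i. \<Psi> (F i)) \<longlonglongrightarrow> \<Psi> f"
    and rotation: "f \<in> Lp_space spherical_lebesgue p \<Longrightarrow> orthogonal_transformation \<theta> \<Longrightarrow>
      \<Psi> (\<lambda>u. f (\<theta> u)) = \<Psi> f"
begin

abbreviation "\<sigma> \<equiv> spherical_lebesgue :: (real^'n) measure"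
abbreviation "\<L> \<equiv> Lp_space spherical_lebesgue p :: (real^'n \<Rightarrow> real) set"

text \<open>The constant sequence \<open>f\<close> converges to \<open>g\<close> in L^p, so
  continuity and uniqueness of limits force equal values.\<close>

lemma cong_AE:
  assumes f: "f \<in> \<L>" and g: "g \<in> \<L>" and "AE u in \<sigma>. f u = g u"
  shows "\<Psi> f = \<Psi> g"
proof -
  note [measurable] = Lp_spaceD(1)[OF f] Lp_spaceD(1)[OF g]
  have "(\<integral>u. \<bar>f u - g u\<bar> powr p \<partial>\<sigma>) = (\<integral>u. 0 \<partial>\<sigma>)"
    using assms(3) by (intro integral_cong_AE) auto
  then have "(\<lambda>i::nat. \<Psi> f) \<longlonglongrightarrow> \<Psi> g" using continuous[of "\<lambda>_. f" g] f g by simp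
  then show ?thesis by (simp add: LIMSEQ_const_iff)
qed

lemma cong:
  assumes "f \<in> \<L>" "g \<in> \<L>" "\<And>u. norm u = 1 \<Longrightarrow> f u = g u"
  shows "\<Psi> f = \<Psi> g"
  using assms by (intro cong_AE AE_I2) auto

text \<open>\<open>f, g\<close> and \<open>f + g, 0\<close> have the same maximum and minimum.\<close>

lemma add_disjoint:
  assumes f: "f \<in> \<L>" and g: "g \<in> \<L>" and disj: "\<And>u. f u = 0 \<or> g u = 0"
  shows "\<Psi> (\<lambda>u. f u + g u) = \<Psi> f + \<Psi> g"
proof -
  note [measurable] = Lp_spaceD(1)[OF f] Lp_spaceD(1)[OF g]
  have "(\<lambda>u. f u + g u) \<in> \<L>"
    by (rule Lp_space_dominated[OF _ _ f g]) (use p in auto)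
  from valuation[OF this spherical.Lp_space_const[of 0]]
  have "\<Psi> (\<lambda>u. f u + g u) = \<Psi> (\<lambda>u. max (f u + g u) 0) + \<Psi> (\<lambda>u. min (f u + g u) 0)"
    by (simp add: zero)
  also have "(\<lambda>u. max (f u + g u) 0) = (\<lambda>u. max (f u) (g u))"
  proof
    show "max (f u + g u) 0 = max (f u) (g u)" for u using disj[of u] by auto
  qed
  also have "(\<lambda>u. min (f u + g u) 0) = (\<lambda>u. min (f u) (g u))"
  proof
    show "min (f u + g u) 0 = min (f u) (g u)" for u using disj[of u] by auto
  qed
  finally show ?thesis using valuation[OF f g] by simp
qed

text \<open>Sequential continuity at 0 in uniform form, applied to a sequence of counterexamples
  with integrals below \<open>1 / real (Suc i)\<close>. It is the source of both the absolute
  continuity of the charges and the growth bound.\<close>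

lemma small_at_zero:
  assumes "e > 0"
  shows "\<exists>d>0. \<forall>f\<in>\<L>. (\<integral>u. \<bar>f u\<bar> powr p \<partial>\<sigma>) < d \<longrightarrow> \<bar>\<Psi> f\<bar> < e"
proof (rule ccontr)
  assume "\<not> ?thesis"
  then have "\<exists>f\<in>\<L>. (\<integral>u. \<bar>f u\<bar> powr p \<partial>\<sigma>) < 1 / real (Suc i) \<and> \<not> \<bar>\<Psi> f\<bar> < e" for i
    by (metis of_nat_0_less_iff zero_less_Suc zero_less_divide_1_iff)
  then obtain F where F: "\<And>i. F i \<in> \<L>" "\<And>i. (\<integral>u. \<bar>F i u\<bar> powr p \<partial>\<sigma>) < 1 / real (Suc i)"
      "\<And>i. \<not> \<bar>\<Psi> (F i)\<bar> < e" by metis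
  have "(\<lambda>i. \<integral>u. \<bar>F i u\<bar> powr p \<partial>\<sigma>) \<longlonglongrightarrow> 0"
    by (rule real_tendsto_sandwich[OF _ _ tendsto_const lim_inverse_n'[THEN LIMSEQ_Suc]])
       (use F(2) in \<open>auto intro!: always_eventually less_imp_le simp del: of_nat_Suc\<close>)
  then have "(\<lambda>i. \<Psi> (F i)) \<longlonglongrightarrow> 0"
    using continuous[of F "\<lambda>u. 0", OF F(1) spherical.Lp_space_const] zero by simp
  then obtain k where "norm (\<Psi> (F k) - 0) < e" using LIMSEQ_D[OF _ assms] by blast
  then show False using F(3) by simp
qed

text \<open>The only possible choice: a representation by \<open>h\<close> must give
  \<open>h a\<close> times the measure of the sphere on the constant function
  \<open>a\<close>.\<close>

definition integrand :: "real \<Rightarrow> real" where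
  "integrand a = \<Psi> (\<lambda>u. a) / measure \<sigma> (sphere 0 1)"

lemma indicator_in_Lp:
  assumes "E \<in> sets \<sigma>"
  shows "(\<lambda>u. a * indicator E u) \<in> \<L>"
proof (rule spherical.Lp_space_bounded)
  show "(\<lambda>u. a * indicator E u) \<in> borel_measurable \<sigma>" using assms by simp
  show "\<bar>a * indicator E u\<bar> \<le> \<bar>a\<bar>" for u by (cases "u \<in> E") auto
qed (use p in simp)

lemma integral_indicator_powr:
  assumes "E \<in> sets \<sigma>"
  shows "(\<integral>u. \<bar>a * indicator E u\<bar> powr p \<partial>\<sigma>) = \<bar>a\<bar> powr p * measure \<sigma> E"
proof -
  have "(\<lambda>u. \<bar>a * indicator E u\<bar> powr p) = (\<lambda>u. \<bar>a\<bar> powr p * indicator E u)"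
    using p by (auto simp: indicator_def)
  then show ?thesis using assms sets.sets_into_space[OF assms] by (simp add: Int_absorb2)
qed

lemma indicator_eq_integrand:
  assumes E: "E \<in> sets \<sigma>"
  shows "\<Psi> (\<lambda>u. a * indicator E u) = integrand a * measure \<sigma> E"
proof -
  define \<nu> where "\<nu> E = \<Psi> (\<lambda>u. a * indicator E u)" for E
  have "\<nu> E = \<nu> (sphere 0 1) / measure \<sigma> (sphere 0 1) * measure \<sigma> E"
  proof (rule rotation_invariant_charge_proportional[OF n _ _ _ E])
    fix A B assume AB: "A \<in> sets \<sigma>" "B \<in> sets \<sigma>" "A \<inter> B = {}"
    have "(\<lambda>u. a * indicator (A \<union> B) u) = (\<lambda>u. a * indicator A u + a * indicator B u)"
      by (simp add: indicator_add[OF AB(3), symmetric] distrib_left)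
    then show "\<nu> (A \<union> B) = \<nu> A + \<nu> B"
      unfolding \<nu>_def using AB by (simp only:) (intro add_disjoint indicator_in_Lp, auto simp: indicator_def)
  next
    fix e :: real assume "e > 0"
    then obtain d where d: "d > 0" "\<And>f. f \<in> \<L> \<Longrightarrow> (\<integral>u. \<bar>f u\<bar> powr p \<partial>\<sigma>) < d \<Longrightarrow> \<bar>\<Psi> f\<bar> < e"
      using small_at_zero by blast
    \<comment> \<open>The summand 1 in the denominator keeps the threshold meaningful for
      \<open>a = 0\<close>.\<close>
    have "\<bar>\<nu> A\<bar> < e" if A: "A \<in> sets \<sigma>" "measure \<sigma> A < d / (\<bar>a\<bar> powr p + 1)" for A
    proof -
      have "\<bar>a\<bar> powr p * measure \<sigma> A \<le> (\<bar>a\<bar> powr p + 1) * measure \<sigma> A"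
        by (intro mult_right_mono) auto
      also have "\<dots> < d"
      proof -
        have "\<bar>a\<bar> powr p + 1 > 0" by (meson add_nonneg_pos powr_ge_zero zero_less_one)
        then show ?thesis using A(2) by (simp add: field_simps)
      qed
      finally show ?thesis
        unfolding \<nu>_def using A by (intro d(2) indicator_in_Lp) (simp_all only: integral_indicator_powr)
    qed
    moreover have "d / (\<bar>a\<bar> powr p + 1) > 0" using d(1) by (simp add: add_nonneg_pos)
    ultimately show "\<exists>d>0. \<forall>A\<in>sets \<sigma>. measure \<sigma> A < d \<longrightarrow> \<bar>\<nu> A\<bar> < e" by blast
  next
    fix \<theta> :: "real^'n \<Rightarrow> real^'n" and E
    assume \<theta>: "orthogonal_transformation \<theta>" and E: "E \<in> sets \<sigma>"
    note m = measurable_orthogonal_spherical[OF \<theta>]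
    \<comment> \<open>The two functions agree on the sphere but may differ elsewhere, hence
      \<open>cong\<close> in place of equality of functions; the evaluation of \<open>\<nu>\<close>
      on the whole sphere below is of the same kind.\<close>
    have "\<nu> (\<theta> -` E \<inter> sphere 0 1) = \<Psi> (\<lambda>u. a * indicator E (\<theta> u))"
      unfolding \<nu>_def
    proof (rule cong)
      show "(\<lambda>u. a * indicator (\<theta> -` E \<inter> sphere 0 1) u) \<in> \<L>"
        using measurable_sets[OF m E] by (intro indicator_in_Lp) simp
      have "(\<lambda>u. a * indicator E (\<theta> u)) \<in> borel_measurable \<sigma>"
        using E by (intro measurable_compose[OF m]) auto
      then show "(\<lambda>u. a * indicator E (\<theta> u)) \<in> \<L>"
        by (rule spherical.Lp_space_bounded[where c = "\<bar>a\<bar>", rotated]) (use p in \<open>auto simp: indicator_def\<close>)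
    qed (auto simp: indicator_def)
    also have "\<dots> = \<nu> E"
      unfolding \<nu>_def by (rule rotation[OF indicator_in_Lp[OF E] \<theta>])
    finally show "\<nu> (\<theta> -` E \<inter> sphere 0 1) = \<nu> E" .
  qed
  moreover have "\<nu> (sphere 0 1) = \<Psi> (\<lambda>u. a)"
    unfolding \<nu>_def using sets.top[of \<sigma>]
    by (intro cong indicator_in_Lp spherical.Lp_space_const) auto
  ultimately show ?thesis by (simp add: \<nu>_def integrand_def)
qed

lemma integrand_zero: "integrand 0 = 0"
  by (simp add: integrand_def zero)

lemma continuous_integrand: "continuous_on UNIV integrand"
  unfolding continuous_on_sequentially
proof (intro allI ballI impI, elim conjE)
  fix x and a :: real assume x: "x \<longlonglongrightarrow> a"
  have "(\<lambda>i. \<bar>x i - a\<bar> powr p) \<longlonglongrightarrow> 0 powr p"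
    using x p by (intro tendsto_powr') (auto simp: LIM_zero tendsto_rabs_zero)
  then have "(\<lambda>i. \<bar>x i - a\<bar> powr p * measure \<sigma> (sphere 0 1)) \<longlonglongrightarrow> 0 * measure \<sigma> (sphere 0 1)"
    by (intro tendsto_mult) auto
  then have "(\<lambda>i. \<Psi> (\<lambda>u. x i)) \<longlonglongrightarrow> \<Psi> (\<lambda>u. a)"
    by (intro continuous spherical.Lp_space_const) (simp add: mult.commute)
  then show "(integrand \<circ> x) \<longlonglongrightarrow> integrand a"
    unfolding integrand_def o_def using measure_sphere_pos[where 'n='n] by (intro tendsto_divide) auto
qed

text \<open>Take a largest subfamily of a partition into pieces below \<open>t / 2\<close> whose
  union still has measure at most \<open>t\<close>. Unless it is the whole partition, one more piece
  would exceed \<open>t\<close>, so the union already has more than \<open>t / 2\<close>.\<close>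

lemma exists_measure_between:
  assumes t: "0 < t" "t \<le> measure \<sigma> (sphere 0 1)"
  shows "\<exists>E\<in>sets \<sigma>. t / 2 \<le> measure \<sigma> E \<and> measure \<sigma> E \<le> t"
proof -
  obtain P where P: "finite P" "disjoint P" "\<Union>P = (sphere 0 1 :: (real^'n) set)"
    "\<And>A. A \<in> P \<Longrightarrow> A \<in> sets \<sigma> \<and> measure \<sigma> A < t / 2"
    using sphere_small_partition[OF n, of "t / 2"] t by auto
  have sets: "\<Union>Q \<in> sets \<sigma>" if "Q \<subseteq> P" for Q
    using that P finite_subset[OF that] by (intro sets.finite_Union) auto
  let ?good = "\<lambda>Q. Q \<subseteq> P \<and> measure \<sigma> (\<Union>Q) \<le> t"
  have "?good {}" using t by simp
  moreover have "\<forall>Q. ?good Q \<longrightarrow> card Q < Suc (card P)"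
    using P(1) card_mono le_imp_less_Suc by blast
  ultimately have "\<exists>Q. ?good Q \<and> (\<forall>R. ?good R \<longrightarrow> card R \<le> card Q)"
    by (rule ex_has_greatest_nat[where P = ?good])
  then obtain Q where Q: "?good Q" "\<And>R. ?good R \<Longrightarrow> card R \<le> card Q" by blast
  have "t / 2 \<le> measure \<sigma> (\<Union>Q)"
  proof (cases "Q = P")
    case True
    then show ?thesis using t P(3) by simp
  next
    case False
    then obtain A where A: "A \<in> P" "A \<notin> Q" using Q(1) by blast
    have "finite Q" using Q(1) P(1) finite_subset by blast
    then have "card (insert A Q) > card Q" using A by simp
    then have "\<not> ?good (insert A Q)" using Q(2) by (meson not_less)
    then have "t < measure \<sigma> (A \<union> \<Union>Q)" using A Q(1) by simp
    also have "\<dots> \<le> measure \<sigma> A + measure \<sigma> (\<Union>Q)"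
      using A P(4) sets Q(1) by (intro measure_Un_le) auto
    also have "\<dots> \<le> t / 2 + measure \<sigma> (\<Union>Q)" using P(4)[OF A(1)] by simp
    finally show ?thesis by simp
  qed
  then show ?thesis using Q(1) sets by blast
qed

text \<open>\<open>\<Psi>\<close> is bounded by \<open>1\<close> on the functions \<open>a * indicator E u\<close> for which \<open>\<bar>a\<bar> powr p\<close> times the
  measure of \<open>E\<close> is below some \<open>d\<close>; for large \<open>a\<close>, choose \<open>E\<close> with this product between \<open>d/4\<close>
  and \<open>d/2\<close>.\<close>

lemma power_growth_integrand: "power_growth p integrand"
proof -
  let ?m = "measure \<sigma> (sphere 0 1)"
  have m: "?m > 0" by (rule measure_sphere_pos)
  obtain d where d: "d > 0" "\<And>f. f \<in> \<L> \<Longrightarrow> (\<integral>u. \<bar>f u\<bar> powr p \<partial>\<sigma>) < d \<Longrightarrow> \<bar>\<Psi> f\<bar> < 1"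
    using small_at_zero[of 1] by auto
  have key: "\<bar>integrand a\<bar> * measure \<sigma> E \<le> 1" if E: "E \<in> sets \<sigma>" "\<bar>a\<bar> powr p * measure \<sigma> E < d" for a E
  proof -
    have "\<bar>\<Psi> (\<lambda>u. a * indicator E u)\<bar> < 1"
      using E by (intro d(2) indicator_in_Lp) (simp_all only: integral_indicator_powr)
    then show ?thesis using indicator_eq_integrand[OF E(1)] by (simp add: abs_mult)
  qed
  \<comment> \<open>The two summands belong to two cases. If even the whole sphere is admissible for
    \<open>key\<close>, it yields \<open>1 / ?m\<close>; otherwise a set of measure at least
    \<open>t / 2 = d / (4 * \<bar>a\<bar> powr p)\<close> yields the first summand.\<close>
  have "\<bar>integrand a\<bar> \<le> 4 / d * \<bar>a\<bar> powr p + 1 / ?m" for a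
  proof (cases "\<bar>a\<bar> powr p * ?m < d")
    case True
    have "sphere 0 1 \<in> sets \<sigma>" using sets.top[of \<sigma>] by simp
    then have "\<bar>integrand a\<bar> \<le> 1 / ?m" using key[OF _ True] m by (simp add: field_simps)
    moreover have "4 / d * \<bar>a\<bar> powr p \<ge> 0" using d(1) by simp
    ultimately show ?thesis by linarith
  next
    case False
    then have a: "\<bar>a\<bar> powr p > 0" using d(1) m by (cases "a = 0") auto
    define t where "t = d / (2 * \<bar>a\<bar> powr p)"
    have t: "0 < t" "t \<le> ?m" using a False d(1) m by (auto simp: t_def field_simps)
    obtain E where E: "E \<in> sets \<sigma>" "t / 2 \<le> measure \<sigma> E" "measure \<sigma> E \<le> t"
      using exists_measure_between[OF t] by blast
    have "\<bar>a\<bar> powr p * measure \<sigma> E \<le> \<bar>a\<bar> powr p * t" using E(3) by (intro mult_left_mono) auto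
    also have "\<dots> < d" using a d(1) by (simp add: t_def)
    finally have "\<bar>integrand a\<bar> * measure \<sigma> E \<le> 1" by (rule key[OF E(1)])
    moreover have "\<bar>integrand a\<bar> * (t / 2) \<le> \<bar>integrand a\<bar> * measure \<sigma> E"
      using E(2) by (intro mult_left_mono) auto
    ultimately have "\<bar>integrand a\<bar> * (t / 2) \<le> 1" by linarith
    then have "\<bar>integrand a\<bar> \<le> 4 / d * \<bar>a\<bar> powr p"
      using a d(1) by (simp add: t_def field_simps)
    then show ?thesis using m by (simp add: add_increasing2)
  qed
  then show ?thesis
    unfolding power_growth_def using d(1) m by (intro exI[of _ "4 / d"] exI[of _ "1 / ?m"] conjI) auto
qed

lemma integrable_integrand: "f \<in> \<L> \<Longrightarrow> integrable \<sigma> (\<lambda>u. integrand (f u))"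
  by (rule spherical.integrable_power_growth[OF _ continuous_integrand power_growth_integrand])

text \<open>Induction over the finite set of values that \<open>f\<close> is allowed to keep, all
  others being replaced by 0. Admitting a new value \<open>a\<close> adds \<open>a\<close> times the
  indicator of its level set, which is disjoint from what was there, so \<open>add_disjoint\<close>
  and \<open>indicator_eq_integrand\<close> apply.\<close>

lemma simple_representation:
  assumes f: "simple_function \<sigma> f" "f \<in> \<L>"
  shows "\<Psi> f = (\<integral>u. integrand (f u) \<partial>\<sigma>)"
proof -
  note [measurable] = Lp_spaceD(1)[OF f(2)]
  define g where "g A u = (if f u \<in> A then f u else 0)" for A u
  have gL: "g A \<in> \<L>" if "finite A" for A
  proof -
    have [measurable]: "A \<in> sets borel" using that by (simp add: finite_imp_closed)
    show ?thesis
      by (rule Lp_space_dominated[OF _ _ f(2) f(2)]) (use p in \<open>auto simp: g_def[abs_def]\<close>)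
  qed
  have "\<Psi> (g A) = (\<integral>u. integrand (g A u) \<partial>\<sigma>)" if "finite A" for A
    using that
  proof (induction A)
    case empty
    then show ?case by (simp add: g_def zero integrand_zero)
  next
    case (insert a A)
    define E where "E = f -` {a} \<inter> space \<sigma>"
    \<comment> \<open>The level set is taken in the full space, not only on the sphere, so that the
      splitting of \<open>g\<close> and the disjointness hold at every point, as
      \<open>add_disjoint\<close> demands.\<close>
    define e where "e u = a * indicator (f -` {a}) u" for u
    have E: "E \<in> sets \<sigma>" unfolding E_def using f(1) by (rule simple_functionD(2))
    have e: "e u = a * indicator E u" if "norm u = 1" for u
      using that by (auto simp: e_def E_def indicator_def)
    have eL: "e \<in> \<L>"
    proof -
      have "e \<in> borel_measurable \<sigma> \<longleftrightarrow> (\<lambda>u. a * indicator E u) \<in> borel_measurable \<sigma>"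
        by (intro measurable_cong) (simp add: e)
      then have "e \<in> borel_measurable \<sigma>" using E by simp
      then show ?thesis
        by (rule spherical.Lp_space_bounded[where c = "\<bar>a\<bar>", rotated]) (use p in \<open>auto simp: e_def indicator_def\<close>)
    qed
    have split: "g (insert a A) = (\<lambda>u. g A u + e u)" and disj: "g A u = 0 \<or> e u = 0" for u
      using insert.hyps(2) by (auto simp: g_def e_def indicator_def)
    have "\<Psi> (g (insert a A)) = \<Psi> (g A) + \<Psi> e"
      unfolding split by (rule add_disjoint[OF gL[OF insert.hyps(1)] eL disj])
    also have "\<Psi> e = \<Psi> (\<lambda>u. a * indicator E u)"
      by (rule cong[OF eL indicator_in_Lp[OF E] e])
    also have "\<dots> = integrand a * measure \<sigma> E" by (rule indicator_eq_integrand[OF E])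
    also have "\<dots> = (\<integral>u. integrand a * indicator E u \<partial>\<sigma>)"
      using E sets.sets_into_space[OF E] by (simp add: Int_absorb2)
    also have "\<dots> = (\<integral>u. integrand (e u) \<partial>\<sigma>)"
      by (intro Bochner_Integration.integral_cong) (auto simp: e indicator_def integrand_zero)
    also have "\<Psi> (g A) + \<dots> = (\<integral>u. integrand (g A u) + integrand (e u) \<partial>\<sigma>)"
      using insert by (simp add: integrable_integrand[OF gL] integrable_integrand[OF eL])
    also have "\<dots> = (\<integral>u. integrand (g (insert a A) u) \<partial>\<sigma>)"
    proof (intro Bochner_Integration.integral_cong refl)
      show "integrand (g A u) + integrand (e u) = integrand (g (insert a A) u)" for u
        using disj[of u] by (auto simp: split integrand_zero)
    qed
    finally show ?case .
  qed
  from this[of "f ` space \<sigma>"] have "\<Psi> (g (f ` space \<sigma>)) = (\<integral>u. integrand (g (f ` space \<sigma>) u) \<partial>\<sigma>)"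
    using f(1) by (simp add: simple_function_def)
  moreover have "\<Psi> (g (f ` space \<sigma>)) = \<Psi> f"
    using f by (intro cong gL) (auto simp: simple_function_def g_def)
  moreover have "(\<integral>u. integrand (g (f ` space \<sigma>) u) \<partial>\<sigma>) = (\<integral>u. integrand (f u) \<partial>\<sigma>)"
    by (intro Bochner_Integration.integral_cong) (auto simp: g_def)
  ultimately show ?thesis by simp
qed

lemma integral_representation:
  assumes f: "f \<in> \<L>"
  shows "\<Psi> f = (\<integral>u. integrand (f u) \<partial>\<sigma>)"
proof -
  have p0: "p > 0" using p by simp
  obtain F where F: "\<And>i. simple_function \<sigma> (F i)" "\<And>i. F i \<in> \<L>"
    "(\<lambda>i. \<integral>u. \<bar>F i u - f u\<bar> powr p \<partial>\<sigma>) \<longlonglongrightarrow> 0"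
    using spherical.Lp_space_simple_approx[OF p0 f] by blast
  have "(\<lambda>i. \<Psi> (F i)) \<longlonglongrightarrow> \<Psi> f" by (rule continuous[OF F(2) f F(3)])
  moreover have "(\<lambda>i. \<Psi> (F i)) \<longlonglongrightarrow> (\<integral>u. integrand (f u) \<partial>\<sigma>)"
    using spherical.tendsto_integral_power_growth[OF p0 continuous_integrand power_growth_integrand F(2) f F(3)]
    by (simp add: simple_representation[OF F(1,2)])
  ultimately show ?thesis by (rule LIMSEQ_unique)
qed

end

section \<open>Complex valuations\<close>

text \<open>The modulus dominates both components and is dominated by the sum of their absolute
  values.\<close>

lemma Lp_fun_iff:
  assumes "p \<ge> 0"
  shows "f \<in> Lp_fun p \<longleftrightarrow> (\<lambda>u. Re (f u)) \<in> Lp_space spherical_lebesgue p \<and>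
    (\<lambda>u. Im (f u)) \<in> Lp_space spherical_lebesgue p"
proof -
  have iff: "f \<in> Lp_fun p \<longleftrightarrow> f \<in> borel_measurable spherical_lebesgue \<and>
      (\<lambda>u. norm (f u)) \<in> Lp_space spherical_lebesgue p"
    by (auto simp: Lp_fun_def Lp_space_def)
  show ?thesis
  proof
    assume "f \<in> Lp_fun p"
    then have f: "f \<in> borel_measurable spherical_lebesgue" "(\<lambda>u. norm (f u)) \<in> Lp_space spherical_lebesgue p"
      by (auto simp: iff)
    show "(\<lambda>u. Re (f u)) \<in> Lp_space spherical_lebesgue p \<and> (\<lambda>u. Im (f u)) \<in> Lp_space spherical_lebesgue p"
    proof
      show "(\<lambda>u. Re (f u)) \<in> Lp_space spherical_lebesgue p"
        by (rule Lp_space_dominated[OF assms _ f(2) f(2)])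
           (use f(1) in \<open>auto simp: borel_measurable_complex_iff intro: order_trans[OF abs_Re_le_cmod]\<close>)
      show "(\<lambda>u. Im (f u)) \<in> Lp_space spherical_lebesgue p"
        by (rule Lp_space_dominated[OF assms _ f(2) f(2)])
           (use f(1) in \<open>auto simp: borel_measurable_complex_iff intro: order_trans[OF abs_Im_le_cmod]\<close>)
    qed
  next
    assume f: "(\<lambda>u. Re (f u)) \<in> Lp_space spherical_lebesgue p \<and> (\<lambda>u. Im (f u)) \<in> Lp_space spherical_lebesgue p"
    then have m: "f \<in> borel_measurable spherical_lebesgue"
      by (auto simp: borel_measurable_complex_iff Lp_space_def)
    moreover have "(\<lambda>u. norm (f u)) \<in> Lp_space spherical_lebesgue p"
      by (rule Lp_space_dominated[OF assms _ conjunct1[OF f] conjunct2[OF f]])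
         (use m in \<open>auto simp: cmod_le\<close>)
    ultimately show "f \<in> Lp_fun p" by (simp add: iff)
  qed
qed

lemma Lp_norm_tendsto_zero_iff:
  assumes "p > 0"
  shows "(\<lambda>i. Lp_norm p (G i)) \<longlonglongrightarrow> 0 \<longleftrightarrow>
    (\<lambda>i. \<integral>u. norm (G i u) powr p \<partial>spherical_lebesgue) \<longlonglongrightarrow> 0"
proof
  have nonneg: "0 \<le> (\<integral>u. norm (G i u) powr p \<partial>spherical_lebesgue)" for i by simp
  show "(\<lambda>i. \<integral>u. norm (G i u) powr p \<partial>spherical_lebesgue) \<longlonglongrightarrow> 0" if "(\<lambda>i. Lp_norm p (G i)) \<longlonglongrightarrow> 0"
  proof -
    have "(\<lambda>i. Lp_norm p (G i) powr p) \<longlonglongrightarrow> 0 powr p"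
      using that assms by (intro tendsto_powr') (auto simp: Lp_norm_def)
    then show ?thesis using assms by (simp add: Lp_norm_def powr_powr)
  qed
  show "(\<lambda>i. Lp_norm p (G i)) \<longlonglongrightarrow> 0" if "(\<lambda>i. \<integral>u. norm (G i u) powr p \<partial>spherical_lebesgue) \<longlonglongrightarrow> 0"
  proof -
    have "(\<lambda>i. (\<integral>u. norm (G i u) powr p \<partial>spherical_lebesgue) powr (1 / p)) \<longlonglongrightarrow> 0 powr (1 / p)"
      using that assms by (intro tendsto_powr') auto
    then show ?thesis using assms by (simp add: Lp_norm_def)
  qed
qed

text \<open>\<open>\<iota>\<close> places a real function on the real or the imaginary axis, and
  \<open>\<rho>\<close> reads off a component of the value; the four combinations correspond to the
  four integrands.\<close>

lemma component_valuation:
  fixes \<Phi> :: "(real^'n \<Rightarrow> complex) set \<Rightarrow> complex"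
  assumes n: "CARD('n) \<ge> 2" and p: "p \<ge> 1"
    and \<Phi>: "Lp_continuous p \<Phi>" "Lp_rotation_invariant p \<Phi>" "Lp_valuation p \<Phi>"
    and \<iota>: "\<iota> = (\<lambda>a. Complex a 0) \<or> \<iota> = (\<lambda>a. Complex 0 a)"
    and \<rho>: "\<rho> = Re \<or> \<rho> = Im"
  shows "rotation_invariant_valuation p (\<lambda>f. \<rho> (\<Phi> (Lp_class p (\<lambda>u. \<iota> (f u)))))"
proof
  have p0: "p > 0" "p \<ge> 0" using p by auto
  have Lp: "(\<lambda>u. \<iota> (f u)) \<in> Lp_fun p" if "f \<in> Lp_space spherical_lebesgue p" for f :: "real^'n \<Rightarrow> real"
    using that \<iota> spherical.Lp_space_const by (auto simp: Lp_fun_iff[OF p0(2)])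
  have \<rho>_add: "\<rho> (z + w) = \<rho> z + \<rho> w" for z w using \<rho> by auto
  have \<rho>_lim: "(\<lambda>i. \<rho> (z i)) \<longlonglongrightarrow> \<rho> w" if "z \<longlonglongrightarrow> w" for z w
    using \<rho> that by (auto intro: tendsto_Re tendsto_Im)
  show "CARD('n) \<ge> 2" "p \<ge> 1" by fact+
  show "\<rho> (\<Phi> (Lp_class p (\<lambda>u. \<iota> 0))) = 0"
    using \<Phi>(3) \<iota> \<rho> by (auto simp: Lp_valuation_def complex_eq_iff zero_complex.code[symmetric])
  show "\<rho> (\<Phi> (Lp_class p (\<lambda>u. \<iota> (max (f u) (g u))))) + \<rho> (\<Phi> (Lp_class p (\<lambda>u. \<iota> (min (f u) (g u)))))
      = \<rho> (\<Phi> (Lp_class p (\<lambda>u. \<iota> (f u)))) + \<rho> (\<Phi> (Lp_class p (\<lambda>u. \<iota> (g u))))"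
    if "f \<in> Lp_space spherical_lebesgue p" "g \<in> Lp_space spherical_lebesgue p" for f g :: "real^'n \<Rightarrow> real"
  proof -
    have "csup (\<lambda>u. \<iota> (f u)) (\<lambda>u. \<iota> (g u)) = (\<lambda>u. \<iota> (max (f u) (g u)))"
      and "cinf (\<lambda>u. \<iota> (f u)) (\<lambda>u. \<iota> (g u)) = (\<lambda>u. \<iota> (min (f u) (g u)))"
      using \<iota> by (auto simp: csup_def cinf_def)
    then show ?thesis
      using \<Phi>(3) Lp[OF that(1)] Lp[OF that(2)] unfolding Lp_valuation_def \<rho>_add[symmetric] by metis
  qed
  show "\<rho> (\<Phi> (Lp_class p (\<lambda>u. \<iota> (f (\<theta> u))))) = \<rho> (\<Phi> (Lp_class p (\<lambda>u. \<iota> (f u))))"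
    if "f \<in> Lp_space spherical_lebesgue p" and \<theta>: "orthogonal_transformation \<theta>"
    for f :: "real^'n \<Rightarrow> real" and \<theta>
  proof -
    \<comment> \<open>Invariance is stated through the inverse rotation, so it is applied to
      \<open>inv \<theta>\<close> in order to compose with \<open>\<theta>\<close> itself.\<close>
    have "inv (inv \<theta>) = \<theta>" using \<theta> by (simp add: inv_inv_eq orthogonal_transformation_bij)
    moreover have "\<Phi> (Lp_class p ((\<lambda>u. \<iota> (f u)) \<circ> inv (inv \<theta>))) = \<Phi> (Lp_class p (\<lambda>u. \<iota> (f u)))"
      using \<Phi>(2) Lp[OF that(1)] orthogonal_transformation_inv[OF \<theta>]
      unfolding Lp_rotation_invariant_def by blast
    ultimately show ?thesis by (simp add: o_def)
  qed
  show "(\<lambda>i. \<rho> (\<Phi> (Lp_class p (\<lambda>u. \<iota> (F i u))))) \<longlonglongrightarrow> \<rho> (\<Phi> (Lp_class p (\<lambda>u. \<iota> (f u))))"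
    if F: "\<And>i. F i \<in> Lp_space spherical_lebesgue p" and f: "f \<in> Lp_space spherical_lebesgue p"
      and lim: "(\<lambda>i. \<integral>u. \<bar>F i u - f u\<bar> powr p \<partial>spherical_lebesgue) \<longlonglongrightarrow> 0"
    for F and f :: "real^'n \<Rightarrow> real"
  proof (rule \<rho>_lim)
    have "norm (\<iota> a - \<iota> b) = \<bar>a - b\<bar>" for a b using \<iota> by (auto simp: cmod_def)
    then have "(\<lambda>i. Lp_norm p (\<lambda>u. \<iota> (F i u) - \<iota> (f u))) \<longlonglongrightarrow> 0"
      using lim by (simp add: Lp_norm_tendsto_zero_iff[OF p0(1)])
    then show "(\<lambda>i. \<Phi> (Lp_class p (\<lambda>u. \<iota> (F i u)))) \<longlonglongrightarrow> \<Phi> (Lp_class p (\<lambda>u. \<iota> (f u)))"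
      by (intro \<Phi>(1)[unfolded Lp_continuous_def, rule_format] Lp F f)
  qed
qed

section \<open>Splitting complex valuations and assembling the four integrands\<close>

lemma Lp_valuation_Re_Im:
  fixes \<Phi> :: "(real^'n \<Rightarrow> complex) set \<Rightarrow> complex"
  assumes p: "p \<ge> 0" and \<Phi>: "Lp_valuation p \<Phi>" and f: "f \<in> Lp_fun p"
  shows "\<Phi> (Lp_class p f) = \<Phi> (Lp_class p (\<lambda>u. Complex (Re (f u)) 0)) + \<Phi> (Lp_class p (\<lambda>u. Complex 0 (Im (f u))))"
proof -
  let ?R = "\<lambda>u. Complex (Re (f u)) 0" and ?I = "\<lambda>u. Complex 0 (Im (f u))"
  have zero: "(\<lambda>u. 0) \<in> Lp_fun p"
    by (simp add: Lp_fun_iff[OF p] spherical.Lp_space_const)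
  have R: "?R \<in> Lp_fun p" "?I \<in> Lp_fun p"
    using f by (auto simp: Lp_fun_iff[OF p] spherical.Lp_space_const)
  have val: "\<Phi> (Lp_class p (csup f g)) + \<Phi> (Lp_class p (cinf f g)) = \<Phi> (Lp_class p f) + \<Phi> (Lp_class p g)"
    if "f \<in> Lp_fun p" "g \<in> Lp_fun p" for f g using \<Phi> that by (simp add: Lp_valuation_def)
  have "csup ?R ?I = csup f (\<lambda>u. 0)" "cinf ?R ?I = cinf f (\<lambda>u. 0)"
    by (auto simp: csup_def cinf_def max.commute min.commute)
  then show ?thesis
    using val[OF f zero] val[OF R] \<Phi> by (simp add: Lp_valuation_def)
qed

lemma Lp_valuation_imp_integral:
  fixes \<Phi> :: "(real^'n \<Rightarrow> complex) set \<Rightarrow> complex"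
  assumes n: "CARD('n) \<ge> 2" and p: "p \<ge> 1"
    and \<Phi>: "Lp_continuous p \<Phi>" "Lp_rotation_invariant p \<Phi>" "Lp_valuation p \<Phi>"
  shows "\<exists>h :: nat \<Rightarrow> real \<Rightarrow> real.
       (\<forall>k\<in>{1,2,3,4}. continuous_on UNIV (h k) \<and> h k 0 = 0 \<and> power_growth p (h k)) \<and>
       (\<forall>f\<in>Lp_fun p. \<Phi> (Lp_class p f) =
          complex_of_real (\<integral>u. h 1 (Re (f u)) + h 3 (Im (f u)) \<partial>spherical_lebesgue) +
          \<i> * complex_of_real (\<integral>u. h 2 (Re (f u)) + h 4 (Im (f u)) \<partial>spherical_lebesgue))"
proof -
  have repr: "\<exists>h. continuous_on UNIV h \<and> h 0 = 0 \<and> power_growth p h \<and>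
      (\<forall>f\<in>Lp_space spherical_lebesgue p. \<rho> (\<Phi> (Lp_class p (\<lambda>u. \<iota> (f u)))) = (\<integral>u. h (f u) \<partial>spherical_lebesgue))"
    if "\<iota> = (\<lambda>a. Complex a 0) \<or> \<iota> = (\<lambda>a. Complex 0 a)" "\<rho> = Re \<or> \<rho> = Im" for \<iota> \<rho>
  proof -
    interpret rotation_invariant_valuation p "\<lambda>f. \<rho> (\<Phi> (Lp_class p (\<lambda>u. \<iota> (f u))))"
      by (rule component_valuation[OF n p \<Phi> that])
    show ?thesis
      by (intro exI[of _ integrand] conjI ballI continuous_integrand integrand_zero
          power_growth_integrand integral_representation)
  qed
  \<comment> \<open>Indices 1 and 2 belong to functions on the real axis, 3 and 4 to functions on
    the imaginary axis; odd indices describe the real part of the value and even ones its imaginary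
    part.\<close>
  obtain h1 where h1: "continuous_on UNIV h1" "h1 0 = 0" "power_growth p h1"
    "\<And>f. f \<in> Lp_space spherical_lebesgue p \<Longrightarrow>
      Re (\<Phi> (Lp_class p (\<lambda>u. Complex (f u) 0))) = (\<integral>u. h1 (f u) \<partial>spherical_lebesgue)"
    using repr[of "\<lambda>a. Complex a 0" Re] by auto
  obtain h2 where h2: "continuous_on UNIV h2" "h2 0 = 0" "power_growth p h2"
    "\<And>f. f \<in> Lp_space spherical_lebesgue p \<Longrightarrow>
      Im (\<Phi> (Lp_class p (\<lambda>u. Complex (f u) 0))) = (\<integral>u. h2 (f u) \<partial>spherical_lebesgue)"
    using repr[of "\<lambda>a. Complex a 0" Im] by auto
  obtain h3 where h3: "continuous_on UNIV h3" "h3 0 = 0" "power_growth p h3"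
    "\<And>f. f \<in> Lp_space spherical_lebesgue p \<Longrightarrow>
      Re (\<Phi> (Lp_class p (\<lambda>u. Complex 0 (f u)))) = (\<integral>u. h3 (f u) \<partial>spherical_lebesgue)"
    using repr[of "\<lambda>a. Complex 0 a" Re] by auto
  obtain h4 where h4: "continuous_on UNIV h4" "h4 0 = 0" "power_growth p h4"
    "\<And>f. f \<in> Lp_space spherical_lebesgue p \<Longrightarrow>
      Im (\<Phi> (Lp_class p (\<lambda>u. Complex 0 (f u)))) = (\<integral>u. h4 (f u) \<partial>spherical_lebesgue)"
    using repr[of "\<lambda>a. Complex 0 a" Im] by auto
  define h :: "nat \<Rightarrow> real \<Rightarrow> real" where
    "h k = (if k = 1 then h1 else if k = 2 then h2 else if k = 3 then h3 else h4)" for k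
  have h_simps: "h 1 = h1" "h 2 = h2" "h 3 = h3" "h 4 = h4" by (simp_all add: h_def)
  have "\<Phi> (Lp_class p f) =
        complex_of_real (\<integral>u. h1 (Re (f u)) + h3 (Im (f u)) \<partial>spherical_lebesgue) +
        \<i> * complex_of_real (\<integral>u. h2 (Re (f u)) + h4 (Im (f u)) \<partial>spherical_lebesgue)"
    if f: "f \<in> Lp_fun p" for f
  proof -
    have R: "(\<lambda>u. Re (f u)) \<in> Lp_space spherical_lebesgue p" and I: "(\<lambda>u. Im (f u)) \<in> Lp_space spherical_lebesgue p"
      using f p by (auto simp: Lp_fun_iff)
    note int = spherical.integrable_power_growth[OF R h1(1,3)] spherical.integrable_power_growth[OF R h2(1,3)]
      spherical.integrable_power_growth[OF I h3(1,3)] spherical.integrable_power_growth[OF I h4(1,3)]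
    have "p \<ge> 0" using p by simp
    from Lp_valuation_Re_Im[OF this \<Phi>(3) f] show ?thesis
      by (simp add: complex_eq_iff int h1(4)[OF R] h2(4)[OF R] h3(4)[OF I] h4(4)[OF I])
  qed
  then show ?thesis
    using h1(1-3) h2(1-3) h3(1-3) h4(1-3) by (intro exI[of _ h]) (simp add: h_simps del: One_nat_def)
qed

text \<open>All three properties are checked on the functionals \<open>J k\<close>, each of which
  sees a single real component. Growth of order \<open>p\<close> makes their integrals finite, so
  that the sums under the integral may be separated, and gives their continuity.\<close>

lemma integral_imp_Lp_valuation:
  fixes \<Phi> :: "(real^'n \<Rightarrow> complex) set \<Rightarrow> complex"
  assumes "p > 0"
    and h: "\<And>k::nat. k \<in> {1,2,3,4} \<Longrightarrow> continuous_on UNIV (h k) \<and> h k 0 = 0 \<and> power_growth p (h k)"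
    and \<Phi>: "\<And>f. f \<in> Lp_fun p \<Longrightarrow> \<Phi> (Lp_class p f) =
      complex_of_real (\<integral>u. h 1 (Re (f u)) + h 3 (Im (f u)) \<partial>spherical_lebesgue) +
      \<i> * complex_of_real (\<integral>u. h 2 (Re (f u)) + h 4 (Im (f u)) \<partial>spherical_lebesgue)"
  shows "Lp_continuous p \<Phi> \<and> Lp_rotation_invariant p \<Phi> \<and> Lp_valuation p \<Phi>"
proof -
  have p: "p \<ge> 0" "p > 0" using assms(1) by auto
  have hk: "continuous_on UNIV (h k)" "h k 0 = 0" "power_growth p (h k)" if "k \<in> {1,2,3,4}" for k
    using h[OF that] by auto
  note [measurable] = borel_measurable_continuous_onI[OF hk(1)]
  have RI: "(\<lambda>u. Re (f u)) \<in> Lp_space spherical_lebesgue p" "(\<lambda>u. Im (f u)) \<in> Lp_space spherical_lebesgue p"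
    if "f \<in> Lp_fun p" for f :: "real^'n \<Rightarrow> complex"
    using that by (auto simp: Lp_fun_iff[OF p(1)])
  define J where "J k g = (\<integral>u. h k (g u) \<partial>spherical_lebesgue)" for k and g :: "real^'n \<Rightarrow> real"
  have int: "integrable spherical_lebesgue (\<lambda>u. h k (g u))"
    if "k \<in> {1,2,3,4}" "g \<in> Lp_space spherical_lebesgue p" for k and g :: "real^'n \<Rightarrow> real"
    using spherical.integrable_power_growth[OF that(2) hk(1,3)] that(1) by blast
  have \<Phi>J: "\<Phi> (Lp_class p f) = Complex (J 1 (\<lambda>u. Re (f u)) + J 3 (\<lambda>u. Im (f u)))
      (J 2 (\<lambda>u. Re (f u)) + J 4 (\<lambda>u. Im (f u)))" if f: "f \<in> Lp_fun p" for f
    using RI[OF f] by (simp add: \<Phi>[OF f] J_def complex_eq_iff int)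
  show "Lp_continuous p \<Phi> \<and> Lp_rotation_invariant p \<Phi> \<and> Lp_valuation p \<Phi>"
  proof (intro conjI)
    show "Lp_continuous p \<Phi>"
      unfolding Lp_continuous_def
    proof (intro allI impI)
      fix F and f :: "real^'n \<Rightarrow> complex"
      assume F: "\<forall>i. F i \<in> Lp_fun p" and f: "f \<in> Lp_fun p"
        and lim: "(\<lambda>i. Lp_norm p (\<lambda>u. F i u - f u)) \<longlonglongrightarrow> 0"
      have F': "F i \<in> Lp_fun p" for i using F by blast
      have lim': "(\<lambda>i. \<integral>u. norm (F i u - f u) powr p \<partial>spherical_lebesgue) \<longlonglongrightarrow> 0"
        using lim by (simp add: Lp_norm_tendsto_zero_iff[OF p(2)])
      have J: "(\<lambda>i. J k (\<lambda>u. \<rho> (F i u))) \<longlonglongrightarrow> J k (\<lambda>u. \<rho> (f u))"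
        if k: "k \<in> {1,2,3,4}" and \<rho>: "\<rho> = Re \<or> \<rho> = Im" for k \<rho>
        unfolding J_def
      proof (rule spherical.tendsto_integral_power_growth[OF p(2) hk(1)[OF k] hk(3)[OF k]])
        show L: "(\<lambda>u. \<rho> (F i u)) \<in> Lp_space spherical_lebesgue p" for i using \<rho> RI[OF F'] by auto
        show Lf: "(\<lambda>u. \<rho> (f u)) \<in> Lp_space spherical_lebesgue p" using \<rho> RI[OF f] by auto
        have le: "(\<integral>u. \<bar>\<rho> (F i u) - \<rho> (f u)\<bar> powr p \<partial>spherical_lebesgue)
            \<le> (\<integral>u. norm (F i u - f u) powr p \<partial>spherical_lebesgue)" for i
        proof (rule integral_mono)
          have D: "(\<lambda>u. g1 u - g2 u) \<in> Lp_space spherical_lebesgue p"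
            if "g1 \<in> Lp_space spherical_lebesgue p" "g2 \<in> Lp_space spherical_lebesgue p" for g1 g2 :: "real^'n \<Rightarrow> real"
            by (rule Lp_space_dominated[OF p(1) _ that]) (use Lp_spaceD(1)[OF that(1)] Lp_spaceD(1)[OF that(2)] in auto)
          show "integrable spherical_lebesgue (\<lambda>u. \<bar>\<rho> (F i u) - \<rho> (f u)\<bar> powr p)"
            using D[OF L Lf] by (simp add: Lp_space_def)
          have "(\<lambda>u. F i u - f u) \<in> Lp_fun p"
            using D RI[OF F'] RI[OF f] by (simp add: Lp_fun_iff[OF p(1)])
          then show "integrable spherical_lebesgue (\<lambda>u. norm (F i u - f u) powr p)"
            by (simp add: Lp_fun_def)
          show "\<bar>\<rho> (F i u) - \<rho> (f u)\<bar> powr p \<le> norm (F i u - f u) powr p" for u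
            using p \<rho> abs_Re_le_cmod[of "F i u - f u"] abs_Im_le_cmod[of "F i u - f u"]
            by (intro powr_mono2) auto
        qed
        show "(\<lambda>i. \<integral>u. \<bar>\<rho> (F i u) - \<rho> (f u)\<bar> powr p \<partial>spherical_lebesgue) \<longlonglongrightarrow> 0"
          by (rule real_tendsto_sandwich[OF _ _ tendsto_const lim']) (use le in auto)
      qed
      show "(\<lambda>i. \<Phi> (Lp_class p (F i))) \<longlonglongrightarrow> \<Phi> (Lp_class p f)"
        unfolding \<Phi>J[OF F'] \<Phi>J[OF f] by (intro tendsto_Complex tendsto_add J) auto
    qed
    show "Lp_rotation_invariant p \<Phi>"
      unfolding Lp_rotation_invariant_def
    proof (intro ballI allI impI)
      fix f :: "real^'n \<Rightarrow> complex" and \<theta> :: "real^'n \<Rightarrow> real^'n"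
      assume f: "f \<in> Lp_fun p" and "orthogonal_transformation \<theta>"
      then have \<eta>: "orthogonal_transformation (inv \<theta>)" using orthogonal_transformation_inv by blast
      note m = measurable_orthogonal_spherical[OF \<eta>]
      have L: "(\<lambda>u. g (inv \<theta> u)) \<in> Lp_space spherical_lebesgue p"
        if g: "g \<in> Lp_space spherical_lebesgue p" for g :: "real^'n \<Rightarrow> real"
      proof -
        note [measurable] = m Lp_spaceD(1)[OF g]
        have "integrable (distr spherical_lebesgue spherical_lebesgue (inv \<theta>)) (\<lambda>u. \<bar>g u\<bar> powr p)"
          using Lp_spaceD(2)[OF g] by (simp add: distr_orthogonal_spherical[OF \<eta>])
        then show ?thesis by (simp add: Lp_space_def integrable_distr_eq)
      qed
      have J: "J k (\<lambda>u. g (inv \<theta> u)) = J k g"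
        if "k \<in> {1,2,3,4}" "g \<in> Lp_space spherical_lebesgue p" for k and g :: "real^'n \<Rightarrow> real"
      proof -
        note [measurable] = m borel_measurable_integrable[OF int[OF that]]
        show ?thesis unfolding J_def
          by (subst (2) distr_orthogonal_spherical[OF \<eta>, symmetric]) (simp add: integral_distr)
      qed
      have "f \<circ> inv \<theta> \<in> Lp_fun p"
        using L[OF RI(1)[OF f]] L[OF RI(2)[OF f]] by (simp add: Lp_fun_iff[OF p(1)])
      then show "\<Phi> (Lp_class p (f \<circ> inv \<theta>)) = \<Phi> (Lp_class p f)"
        by (simp add: \<Phi>J f J[OF _ RI(1)[OF f]] J[OF _ RI(2)[OF f]])
    qed
    show "Lp_valuation p \<Phi>"
      unfolding Lp_valuation_def
    proof (intro conjI ballI)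
      fix f g :: "real^'n \<Rightarrow> complex" assume f: "f \<in> Lp_fun p" and g: "g \<in> Lp_fun p"
      have L: "(\<lambda>u. max (a u) (b u)) \<in> Lp_space spherical_lebesgue p" "(\<lambda>u. min (a u) (b u)) \<in> Lp_space spherical_lebesgue p"
        if "a \<in> Lp_space spherical_lebesgue p" "b \<in> Lp_space spherical_lebesgue p" for a b :: "real^'n \<Rightarrow> real"
        by (rule Lp_space_dominated[OF p(1) _ that],
            use Lp_spaceD(1)[OF that(1)] Lp_spaceD(1)[OF that(2)] in auto)+
      have J: "J k (\<lambda>u. max (a u) (b u)) + J k (\<lambda>u. min (a u) (b u)) = J k a + J k b"
        if k: "k \<in> {1,2,3,4}" and ab: "a \<in> Lp_space spherical_lebesgue p" "b \<in> Lp_space spherical_lebesgue p"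
        for k and a b :: "real^'n \<Rightarrow> real"
      proof -
        have "J k (\<lambda>u. max (a u) (b u)) + J k (\<lambda>u. min (a u) (b u))
            = (\<integral>u. h k (max (a u) (b u)) + h k (min (a u) (b u)) \<partial>spherical_lebesgue)"
          using int[OF k L(1)[OF ab]] int[OF k L(2)[OF ab]] by (simp add: J_def)
        also have "\<dots> = (\<integral>u. h k (a u) + h k (b u) \<partial>spherical_lebesgue)"
          by (intro Bochner_Integration.integral_cong) (auto simp: max_def min_def)
        also have "\<dots> = J k a + J k b" using int[OF k ab(1)] int[OF k ab(2)] by (simp add: J_def)
        finally show ?thesis .
      qed
      have s: "csup f g \<in> Lp_fun p" and i: "cinf f g \<in> Lp_fun p"
        using L[OF RI(1)[OF f] RI(1)[OF g]] L[OF RI(2)[OF f] RI(2)[OF g]]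
        by (simp_all add: Lp_fun_iff[OF p(1)] csup_def cinf_def)
      have Jc: "J k (\<lambda>u. \<rho> (csup f g u)) + J k (\<lambda>u. \<rho> (cinf f g u)) = J k (\<lambda>u. \<rho> (f u)) + J k (\<lambda>u. \<rho> (g u))"
        if "k \<in> {1,2,3,4}" "\<rho> = Re \<or> \<rho> = Im" for k \<rho>
        using that(2) J[OF that(1) RI(1)[OF f] RI(1)[OF g]] J[OF that(1) RI(2)[OF f] RI(2)[OF g]]
        by (auto simp: csup_def cinf_def)
      show "\<Phi> (Lp_class p (csup f g)) + \<Phi> (Lp_class p (cinf f g)) = \<Phi> (Lp_class p f) + \<Phi> (Lp_class p g)"
        unfolding \<Phi>J[OF s] \<Phi>J[OF i] \<Phi>J[OF f] \<Phi>J[OF g]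
        using Jc[of 1 Re] Jc[of 2 Re] Jc[of 3 Im] Jc[of 4 Im] by (simp add: complex_eq_iff)
    next
      have "(\<lambda>u. 0) \<in> Lp_fun p" by (simp add: Lp_fun_iff[OF p(1)] spherical.Lp_space_const)
      from \<Phi>J[OF this] show "\<Phi> (Lp_class p (\<lambda>u. 0)) = 0"
        by (simp add: J_def hk complex_eq_iff)
    qed
  qed
qed

theorem theorem1p3:
  fixes p :: real and \<Phi> :: "(real^'n \<Rightarrow> complex) set \<Rightarrow> complex"
  assumes "CARD('n) \<ge> 2" and "p \<ge> 1"
  shows "(Lp_continuous p \<Phi> \<and> Lp_rotation_invariant p \<Phi> \<and> Lp_valuation p \<Phi>) \<longleftrightarrow>
    (\<exists>h :: nat \<Rightarrow> real \<Rightarrow> real.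
       (\<forall>k\<in>{1,2,3,4}. continuous_on UNIV (h k) \<and> h k 0 = 0 \<and>
          (\<exists>\<gamma>\<ge>0. \<exists>\<delta>\<ge>0. \<forall>a. \<bar>h k a\<bar> \<le> \<gamma> * \<bar>a\<bar> powr p + \<delta>)) \<and>
       (\<forall>f\<in>Lp_fun p. \<Phi> (Lp_class p f) =
          complex_of_real (\<integral>u. h 1 (Re (f u)) + h 3 (Im (f u)) \<partial>spherical_lebesgue) +
          \<i> * complex_of_real (\<integral>u. h 2 (Re (f u)) + h 4 (Im (f u)) \<partial>spherical_lebesgue)))"
  unfolding power_growth_def[symmetric]
proof (intro iffI; (elim conjE exE)?)
  assume "Lp_continuous p \<Phi>" "Lp_rotation_invariant p \<Phi>" "Lp_valuation p \<Phi>"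
  then show "\<exists>h :: nat \<Rightarrow> real \<Rightarrow> real.
       (\<forall>k\<in>{1,2,3,4}. continuous_on UNIV (h k) \<and> h k 0 = 0 \<and> power_growth p (h k)) \<and>
       (\<forall>f\<in>Lp_fun p. \<Phi> (Lp_class p f) =
          complex_of_real (\<integral>u. h 1 (Re (f u)) + h 3 (Im (f u)) \<partial>spherical_lebesgue) +
          \<i> * complex_of_real (\<integral>u. h 2 (Re (f u)) + h 4 (Im (f u)) \<partial>spherical_lebesgue))"
    by (rule Lp_valuation_imp_integral[OF assms])
next
  fix h :: "nat \<Rightarrow> real \<Rightarrow> real"
  assume h: "\<forall>k\<in>{1,2,3,4}. continuous_on UNIV (h k) \<and> h k 0 = 0 \<and> power_growth p (h k)"
    and \<Phi>: "\<forall>f\<in>Lp_fun p. \<Phi> (Lp_class p f) =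
          complex_of_real (\<integral>u. h 1 (Re (f u)) + h 3 (Im (f u)) \<partial>spherical_lebesgue) +
          \<i> * complex_of_real (\<integral>u. h 2 (Re (f u)) + h 4 (Im (f u)) \<partial>spherical_lebesgue)"
  show "Lp_continuous p \<Phi> \<and> Lp_rotation_invariant p \<Phi> \<and> Lp_valuation p \<Phi>"
    by (rule integral_imp_Lp_valuation[where h = h]) (use assms(2) bspec[OF h] bspec[OF \<Phi>] in auto)
qed

end
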